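(* Let $X=\{0,1,2,3\}$ and let $G$ be the group generated by the transformations $e_1,e_2,e_3$ of $X^\ast\cup X^\infty$ defined recursively by $e_i(0w)=i\,e_i(w)$, $e_i(iw)=0w$, $e_i(jw)=jw$ for $j\notin\{0,i\}$. Let $\Gamma$ be any infinite Schreier graph of $G$, i.e. for some $w\in X^\infty$ the graph whose vertex set is the $G$-orbit of $w$ and with an edge joining $v$ and $e_i(v)$ for each vertex $v$ and each $i\in\{1,2,3\}$. Define $Q_1=\{\sqrt{14}\}$, $Q_{m+1}=\{\sqrt{12+sq}: q\in Q_m,\ s\in\{1,-1\}\}$, and $R_n=\{2+sq: q\in Q_n,\ s\in\{1,-1\}\}$ for $n\ge1$ (the points of the form $2\pm\sqrt{12\pm\sqrt{12\pm\cdots\pm\sqrt{14}}}$ with $n$ radicals). Then the spectrum of (the adjacency operator of) $\Gamma$ is the closure of $\{4\}\cup\bigcup_{n\ge1}R_n$. This set is the union of a Cantor set of zero Lebesgue measure which is symmetric about $2$ and a countable collection of isolated points supporting the KNS spectral measure $\mu$; $\mu$ is discrete, with $\mu(\{x\})=\frac{1}{2\cdot 4^n}$ for each $x\in R_n$, $n\ge1$, and $\mu(\{4\})=\frac12$.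
   Context: The adjacency operator of $\Gamma$ acts on $\ell^2$ of the vertex set, with loops (at fixed points of $e_i$) contributing $2$ to the diagonal entry. Let $\Gamma_n$ be the finite Schreier graph on $X^n$ (same edge rule) and $A_n=\sum_{i=1}^3(M_i+M_i^{T})$ its adjacency matrix, $M_i$ the permutation matrix of $e_i$ on $X^n$. The KNS (Kesten–Neumann–Serre) spectral measure $\mu$ is the weak limit as $n\to\infty$ of the counting measures $\mu_n=4^{-n}\sum_{\lambda}\delta_{\lambda}$, the sum running over the eigenvalues of $A_n$ with multiplicity. *)

theory Defs
  imports "HOL-Probability.Probability" "HOL-Computational_Algebra.Polynomial"
          "HOL-Combinatorics.Permutations"
begin

definition Xinf :: "(nat \<Rightarrow> nat) set" where
  "Xinf = {w. \<forall>k. w k < 4}"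

definition Wn :: "nat \<Rightarrow> nat list set" where
  "Wn n = {xs. length xs = n \<and> set xs \<subseteq> {0..<4}}"

fun ei_fin :: "nat \<Rightarrow> nat list \<Rightarrow> nat list" where
  "ei_fin i [] = []"
| "ei_fin i (x # w) =
     (if x = 0 then i # ei_fin i w else if x = i then 0 # w else x # w)"

text \<open>e_i on infinite words: it is length preserving on prefixes, so the
  k-th letter of e_i(w) is the k-th letter of e_i applied to the prefix of
  length k+1.\<close>

definition ei :: "nat \<Rightarrow> (nat \<Rightarrow> nat) \<Rightarrow> (nat \<Rightarrow> nat)" where
  "ei i w = (\<lambda>k. ei_fin i (map w [0..<Suc k]) ! k)"

inductive_set orbit :: "(nat \<Rightarrow> nat) \<Rightarrow> (nat \<Rightarrow> nat) set" for w where
  base: "w \<in> orbit w"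
| fwd: "v \<in> orbit w \<Longrightarrow> i \<in> {1,2,3} \<Longrightarrow> ei i v \<in> orbit w"
| bwd: "v \<in> orbit w \<Longrightarrow> i \<in> {1,2,3} \<Longrightarrow> u \<in> Xinf \<Longrightarrow> ei i u = v \<Longrightarrow> u \<in> orbit w"

definition l2 :: "'a set \<Rightarrow> ('a \<Rightarrow> complex) set" where
  "l2 V = {f. (\<forall>v. v \<notin> V \<longrightarrow> f v = 0) \<and> (\<lambda>v. (cmod (f v))\<^sup>2) summable_on V}"

text \<open>Adjacency operator of the Schreier graph on vertex set V:
  A = sum_i (M_i + M_i^T); a loop (e_i v = v) contributes 2 on the diagonal.\<close>

definition adj_op :: "(nat \<Rightarrow> nat) set \<Rightarrow> ((nat \<Rightarrow> nat) \<Rightarrow> complex) \<Rightarrow> ((nat \<Rightarrow> nat) \<Rightarrow> complex)" where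
  "adj_op V f = (\<lambda>v. if v \<in> V then
      (\<Sum>i\<in>{1,2,3::nat}. f (ei i v) + infsum f {u \<in> V. ei i u = v}) else 0)"

text \<open>Spectrum of an operator T on l^2(V): the complex z for which T - z I is
  not a bijection of l^2(V) (for bounded T this is the usual spectrum, by the
  bounded inverse theorem).\<close>

definition op_spectrum :: "'a set \<Rightarrow> (('a \<Rightarrow> complex) \<Rightarrow> ('a \<Rightarrow> complex)) \<Rightarrow> complex set" where
  "op_spectrum V T = {z. \<not> bij_betw (\<lambda>f v. T f v - z * f v) (l2 V) (l2 V)}"

definition An :: "nat list \<Rightarrow> nat list \<Rightarrow> real" where
  "An u v = (\<Sum>i\<in>{1,2,3::nat}. (if ei_fin i u = v then 1 else 0) + (if ei_fin i v = u then 1 else 0))"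

text \<open>Characteristic polynomial det(x I - A_n), Leibniz formula over the index set X^n.\<close>

definition charpoly :: "nat \<Rightarrow> real poly" where
  "charpoly n = (\<Sum>p\<in>{p. p permutes Wn n}. of_int (sign p) *
      (\<Prod>u\<in>Wn n. [: - An u (p u), (if p u = u then 1 else 0) :]))"

definition mu_n :: "nat \<Rightarrow> real measure" where
  "mu_n n = measure_of UNIV (sets borel)
     (\<lambda>A. ennreal (real (size (filter_mset (\<lambda>x. x \<in> A) (proots (charpoly n)))) / 4 ^ n))"

fun Q :: "nat \<Rightarrow> real set" where
  "Q 0 = {}"
| "Q (Suc 0) = {sqrt 14}"
| "Q (Suc (Suc m)) = {sqrt (12 + s * q) | q s. q \<in> Q (Suc m) \<and> s \<in> {1, -1}}"

definition R :: "nat \<Rightarrow> real set" where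
  "R n = {2 + s * q | q s. q \<in> Q n \<and> s \<in> {1, -1}}"

definition cantor_set :: "real set \<Rightarrow> bool" where
  "cantor_set C \<longleftrightarrow> C \<noteq> {} \<and> compact C \<and> (\<forall>x\<in>C. x islimpt C) \<and>
     (\<forall>T\<subseteq>C. connected T \<longrightarrow> (\<exists>a. T \<subseteq> {a}))"

end

theory Submission
  imports Defs "Jordan_Normal_Form.Determinant"
begin

text \<open>
  Splitting a word into its first letter and the rest turns the adjacency operator into a
  $4 \times 4$ block operator whose lower right $3 \times 3$ block is the scalar $4$.
  The Schur complement of $A - z$ with respect to this block is, up to the factor $4 - z$, the
  operator $A' - q(z)$ of the orbit of the shifted word, where $q(z) = z^2 - 4z - 6$.  Hence, for
  $z \neq 4$, $z$ is in the spectrum of $A$ iff $q(z)$ is in the spectrum of $A'$, while $4$ is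
  always in the spectrum.  So the spectrum contains all iterated preimages of $4$ (these are
  the points of $R_n$) and otherwise only points with bounded $q$-orbit: an escaping point is
  eventually larger than the norm $6$.  In the coordinate $y = z - 2$ the map is
  $y \mapsto y^2 - 12$, whose filled Julia set is a Cantor set in $[-4,4]$ on which the inverse
  branches contract by $1/5$.

  The same Schur complement at finite level gives
  $\chi_{n+1}(x) = (x-4)^{2 \cdot 4^n} \chi_n(q(x))$ with $\chi_0(x) = x - 6$, which yields all
  eigenvalues with multiplicities.
\<close>

section \<open>Dynamics of the quadratic map\<close>

text \<open>The obstacle is the Julia set. Orbits inside it neither hit 4 nor grow past the norm, so
  the reduction alone never decides these points. They are limits of the points of R_n, but here the
  spectrum is defined by failing bijectivity, and its closedness would have to come from the bounded
  inverse theorem. Instead, for each Julia point a square summable right-hand side without a square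
  summable solution is constructed.

  The contraction rate comes from radicands being at least 8: the map expands by at least 2 sqrt 8 >
  5. As each point has two preimages and 2/5 < 1, the same estimate gives measure zero and hence
  total disconnectedness.

  The exponent 2 * 4^n counts the 3 * 4^n words with nonzero first letter minus the 4^n denominators
  x - 4 of the Schur complement. The root 6 of chi_0 comes from the three loops at the empty word.
  It is a fixed point of q with only 2^n preimages of order n among 4^n eigenvalues, so its
  contribution disappears in the limit and the spectral measure lives on the preimages of 4.\<close>

definition quad :: "'a::comm_ring_1 \<Rightarrow> 'a" where
  "quad x = x\<^sup>2 - 4 * x - 6"

text \<open>Level 0 absorbs the exceptional point 4, so that the masses 1/2 and 1/(2 * 4^n) become
  one formula; for n >= 1 this is \<open>R n\<close> (\<open>R_eq_level\<close>).\<close>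

definition level :: "nat \<Rightarrow> real set" where
  "level n = {x. (quad ^^ n) x = 4}"

text \<open>In this interval 6 is the repelling fixed point and -2 the other preimage of 6; an orbit
  that leaves it never returns (\<open>quad_outside\<close>).\<close>

definition julia :: "real set" where
  "julia = {x. \<forall>n. (quad ^^ n) x \<in> {-2..6}}"

lemma quad_shift: "quad x = (x - 2)\<^sup>2 - (10 :: 'a :: comm_ring_1)"
  by (simp add: quad_def power2_eq_square algebra_simps)

lemma quad_of_real: "quad (of_real x :: complex) = of_real (quad x)"
  by (simp add: quad_def)

lemma funpow_quad_of_real: "(quad ^^ n) (of_real x :: complex) = of_real ((quad ^^ n) x)"
  by (induction n) (simp_all add: quad_of_real)

lemma funpow_Suc_apply: "(f ^^ Suc n) x = (f ^^ n) (f x)"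
  by (simp add: funpow_swap1)

lemma quad_outside:
  fixes x :: real
  assumes "x \<notin> {-2..6}"
  shows "quad x \<notin> {-2..6}"
proof -
  have "\<bar>x - 2\<bar> > 4" using assms by auto
  then have "(x - 2)\<^sup>2 > 4\<^sup>2"
    by (metis abs_le_square_iff abs_numeral linorder_not_less)
  then show ?thesis by (simp add: quad_shift)
qed

text \<open>The complement of [-2,6] is forward invariant, so one late visit to the interval
  certifies all earlier times.\<close>

lemma funpow_quad_inside:
  fixes x :: real
  assumes "(quad ^^ n) x \<in> {-2..6}" "k \<le> n"
  shows "(quad ^^ k) x \<in> {-2..6}"
proof (rule ccontr)
  assume out: "(quad ^^ k) x \<notin> {-2..6}"
  have "(quad ^^ j) ((quad ^^ k) x) \<notin> {-2..6}" for j
    by (induction j) (use out quad_outside in auto)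
  from this[of "n - k"] assms show False
    by (simp flip: funpow_add[THEN fun_cong, simplified o_apply])
qed

lemma level_0: "level 0 = {4}"
  by (simp add: level_def)

lemma level_Suc: "level (Suc n) = quad -` level n"
  by (auto simp: level_def funpow_swap1)

lemma level_inside: "level n \<subseteq> {-2..6}"
  using funpow_quad_inside[of n _ 0] by (auto simp: level_def)

section \<open>Iterated preimages of 4 as nested radicals\<close>

lemma quad_eq_iff:
  fixes a :: real
  assumes "a \<in> {-2..6}"
  shows "quad x = a \<longleftrightarrow> x = 2 + sqrt (10 + a) \<or> x = 2 - sqrt (10 + a)"
proof -
  have "quad x = a \<longleftrightarrow> (x - 2)\<^sup>2 = (sqrt (10 + a))\<^sup>2"
    using assms by (auto simp: quad_shift)
  also have "\<dots> \<longleftrightarrow> x = 2 + sqrt (10 + a) \<or> x = 2 - sqrt (10 + a)"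
    by (auto simp: power2_eq_iff)
  finally show ?thesis .
qed

lemma Q_bounds: "q \<in> Q n \<Longrightarrow> 0 \<le> q \<and> q \<le> 4"
proof (induction n arbitrary: q rule: Q.induct)
  case 2
  then show ?case by (auto intro: real_le_lsqrt)
next
  case (3 m)
  then obtain q' s where q: "q = sqrt (12 + s * q')" "q' \<in> Q (Suc m)" "s \<in> {1, -1}"
    by auto
  with 3(1)[of q'] show ?case by (auto intro!: real_le_lsqrt)
qed auto

text \<open>In y = x - 2 the equation \<open>quad x = 2 + s * q\<close> reads y^2 = 12 + s q, so one
  more outer radical is one more pullback. The innermost 14 is 10 + 4, from pulling back 4 itself.
  \<open>Q_bounds\<close> keeps the radicands nonnegative.\<close>

lemma R_eq_level: "R (Suc n) = level (Suc n)"
proof (induction n)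
  case 0
  have "x \<in> R (Suc 0) \<longleftrightarrow> x = 2 + sqrt 14 \<or> x = 2 - sqrt 14" for x
    unfolding R_def by force
  then show ?case
    using quad_eq_iff[of 4] by (auto simp: level_Suc level_0)
next
  case (Suc n)
  have "x \<in> R (Suc (Suc n)) \<longleftrightarrow> quad x \<in> R (Suc n)" for x
  proof
    assume "x \<in> R (Suc (Suc n))"
    then obtain s t q where x: "x = 2 + t * sqrt (12 + s * q)" "q \<in> Q (Suc n)"
        "s \<in> {1, -1}" "t \<in> {1, -1}"
      by (auto simp: R_def)
    have "12 + s * q \<ge> 0" using Q_bounds[OF x(2)] x(3) by auto
    then have "quad x = 2 + s * q" using x(4) unfolding x(1) by (auto simp: quad_shift)
    with x show "quad x \<in> R (Suc n)" by (auto simp: R_def)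
  next
    assume "quad x \<in> R (Suc n)"
    then obtain s q where s: "quad x = 2 + s * q" "q \<in> Q (Suc n)" "s \<in> {1, -1}"
      by (auto simp: R_def)
    then have "(x - 2)\<^sup>2 = 12 + s * q" by (simp add: quad_shift)
    then have abs: "\<bar>x - 2\<bar> = sqrt (12 + s * q)" by (metis real_sqrt_abs)
    have mem: "sqrt (12 + s * q) \<in> Q (Suc (Suc n))" using s(2,3) by auto
    have "x = 2 + 1 * sqrt (12 + s * q) \<or> x = 2 + (-1) * sqrt (12 + s * q)"
      using abs by (auto simp: abs_if split: if_splits)
    then show "x \<in> R (Suc (Suc n))"
      unfolding R_def using mem by blast
  qed
  then show ?case using Suc level_Suc[of "Suc n"] by auto
qed

lemma points_eq_levels: "{4} \<union> (\<Union>n\<in>{1..}. R n) = (\<Union>n. level n)"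
proof -
  have "(\<Union>n\<in>{1..}. R n) = (\<Union>n. level (Suc n))"
    using R_eq_level by (auto simp: Suc_le_eq gr0_conv_Suc) (metis R_eq_level Suc_leI zero_less_Suc)
  moreover have "(\<Union>n. level n) = level 0 \<union> (\<Union>n. level (Suc n))"
  proof (intro equalityI subsetI)
    fix x assume "x \<in> (\<Union>n. level n)"
    then obtain n where "x \<in> level n" by auto
    then show "x \<in> level 0 \<union> (\<Union>n. level (Suc n))" by (cases n) auto
  qed auto
  ultimately show ?thesis by (simp add: level_0)
qed

section \<open>Counting preimages\<close>

lemma vimage_quad_singleton:
  fixes a :: real
  assumes "a \<in> {-2..6}"
  shows "quad -` {a} = {2 + sqrt (10 + a), 2 - sqrt (10 + a)}"
  using quad_eq_iff[OF assms] by auto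

lemma finite_vimage_quad:
  fixes B :: "real set"
  assumes "finite B" "B \<subseteq> {-2..6}"
  shows "finite (quad -` B)"
proof -
  have "quad -` B = (\<Union>a\<in>B. quad -` {a})" by auto
  also have "finite \<dots>" using assms by (auto simp: vimage_quad_singleton subset_iff)
  finally show ?thesis .
qed

text \<open>The general monoid serves two uses: constant factors 2 count preimages
  (\<open>card_vimage_quad\<close>), linear factors give the composition rule
  \<open>pcompose_root_poly\<close>.\<close>

lemma prod_vimage_quad:
  fixes h :: "real \<Rightarrow> 'a :: comm_monoid_mult"
  assumes "finite B" "B \<subseteq> {-2..6}"
  shows "prod h (quad -` B) = (\<Prod>a\<in>B. h (2 + sqrt (10 + a)) * h (2 - sqrt (10 + a)))"
proof -
  have "prod h (quad -` B) = prod h (\<Union>a\<in>B. quad -` {a})"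
    by (rule prod.cong) auto
  also have "\<dots> = (\<Prod>a\<in>B. prod h (quad -` {a}))"
    using assms finite_vimage_quad[of "{_}"] by (intro prod.UNION_disjoint) (auto simp: subset_iff)
  also have "\<dots> = (\<Prod>a\<in>B. h (2 + sqrt (10 + a)) * h (2 - sqrt (10 + a)))"
  proof (rule prod.cong)
    fix a assume "a \<in> B"
    then have a: "a \<in> {-2..6}" using assms by auto
    then have "sqrt (10 + a) > 0" by simp
    then show "prod h (quad -` {a}) = h (2 + sqrt (10 + a)) * h (2 - sqrt (10 + a))"
      by (subst vimage_quad_singleton[OF a], subst prod.insert) auto
  qed simp
  finally show ?thesis .
qed

lemma card_vimage_quad:
  fixes B :: "real set"
  assumes "finite B" "B \<subseteq> {-2..6}"
  shows "card (quad -` B) = 2 * card B"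
proof -
  have "(2::nat) ^ card (quad -` B) = (\<Prod>a\<in>B. 2 * 2)"
    unfolding prod_constant[symmetric] by (rule prod_vimage_quad[OF assms])
  also have "\<dots> = 2 ^ (2 * card B)" by (simp add: power_mult)
  finally show ?thesis by (simp only: power_inject_exp)
qed

lemma finite_level: "finite (level n)"
  by (induction n) (simp_all add: level_0 level_Suc finite_vimage_quad level_inside)

lemma card_level: "card (level n) = 2 ^ n"
  by (induction n) (simp_all add: level_0 level_Suc card_vimage_quad level_inside finite_level)

lemma funpow_quad_neg6:
  "(quad ^^ n) (-6 :: real) \<notin> {-2..6}"
  using funpow_quad_inside[of n "-6" 0] by auto

text \<open>A point that hits 4 is sent to -6 next and has escaped. This separates the levels from
  each other and from the Julia set, and later isolates their points.\<close>

lemma funpow_quad_level: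
  assumes "x \<in> level n" "n < m"
  shows "(quad ^^ m) x \<notin> {-2..6}"
proof -
  have "quad (4::real) = -6" by (simp add: quad_def)
  then have "(quad ^^ Suc n) x = -6" using assms by (simp add: level_def)
  moreover have "(quad ^^ m) x = (quad ^^ (m - Suc n)) ((quad ^^ Suc n) x)"
    using assms(2) funpow_add[of "m - Suc n" "Suc n" "quad :: real \<Rightarrow> real"] by simp
  ultimately show ?thesis using funpow_quad_neg6 by metis
qed

lemma level_julia_disjoint: "level n \<inter> julia = {}"
  using funpow_quad_level[of _ n "Suc n"] unfolding julia_def by blast

lemma level_disjoint: "m \<noteq> n \<Longrightarrow> level m \<inter> level n = {}"
proof -
  have "x \<notin> level n" if "m < n" "x \<in> level m" for x m n
    using funpow_quad_level[OF that(2,1)] by (auto simp: level_def)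
  then show "m \<noteq> n \<Longrightarrow> level m \<inter> level n = {}"
    by (metis disjoint_iff linorder_neqE_nat)
qed

section \<open>Contracting inverse branches and the topology of the Julia set\<close>

lemma sqrt_contraction:
  fixes a b :: real
  assumes "a \<ge> 8" "b \<ge> 8"
  shows "\<bar>sqrt a - sqrt b\<bar> \<le> \<bar>a - b\<bar> / 5"
proof -
  \<comment> \<open>5/2 is a rational bound below sqrt 8, and the sum of the two roots yields the 5.
    In the application the radicands are 10 plus a point of [-2,6].\<close>
  have "sqrt a \<ge> 5/2" "sqrt b \<ge> 5/2"
    using assms by (intro real_le_rsqrt; simp add: power2_eq_square)+
  then have "\<bar>sqrt a - sqrt b\<bar> * 5 \<le> \<bar>sqrt a - sqrt b\<bar> * (sqrt a + sqrt b)"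
    by (intro mult_left_mono) auto
  also have "\<dots> = \<bar>(sqrt a - sqrt b) * (sqrt a + sqrt b)\<bar>"
    using assms by (simp add: abs_mult)
  also have "(sqrt a - sqrt b) * (sqrt a + sqrt b) = a - b"
    using assms by (simp add: algebra_simps)
  finally show ?thesis by simp
qed

text \<open>Every point staying in $[-2,6]$ for $n$ steps is close to an $n$-th preimage of any
  prescribed point of $[-2,6]$: follow the same inverse branches, which contract by $1/5$.\<close>

lemma quad_pullback:
  fixes x t :: real
  assumes "(quad ^^ n) x \<in> {-2..6}" "t \<in> {-2..6}"
  shows "\<exists>x'. (quad ^^ n) x' = t \<and> \<bar>x' - x\<bar> \<le> 8 / 5 ^ n"
  using assms(1)
proof (induction n arbitrary: x)
  case 0
  \<comment> \<open>The constant 8 is the length of [-2,6].\<close>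
  then show ?case using assms(2) by auto
next
  case (Suc n)
  then have q: "(quad ^^ n) (quad x) \<in> {-2..6}" by (simp add: funpow_swap1)
  from Suc.IH[OF this] obtain y where y: "(quad ^^ n) y = t" "\<bar>y - quad x\<bar> \<le> 8 / 5 ^ n"
    by auto
  have ran: "y \<in> {-2..6}" "quad x \<in> {-2..6}"
    using funpow_quad_inside[of n y 0] y(1) assms(2) funpow_quad_inside[OF q, of 0] by auto
  obtain s where s: "s \<in> {1, -1}" "x = 2 + s * sqrt (10 + quad x)"
    using quad_eq_iff[OF ran(2), of x] by (auto intro: that[of 1] that[of "-1"])
  define x' where "x' = 2 + s * sqrt (10 + y)"
  have "quad x' = y" using quad_eq_iff[OF ran(1), of x'] s(1) by (auto simp: x'_def)
  moreover have "\<bar>x' - x\<bar> = \<bar>sqrt (10 + y) - sqrt (10 + quad x)\<bar>"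
    using s(1) by (subst s(2)) (auto simp: x'_def)
  moreover have "\<dots> \<le> \<bar>(10 + y) - (10 + quad x)\<bar> / 5"
    by (rule sqrt_contraction) (use ran in auto)
  ultimately show ?case using y by (intro exI[of _ x']) (auto simp: funpow_swap1)
qed

lemma eight_div_power_tendsto: "(\<lambda>n. 8 / 5 ^ n :: real) \<longlonglongrightarrow> 0"
  using tendsto_mult_left[OF LIMSEQ_power_zero[of "1/5::real"], of 8] by (simp add: power_divide)

lemma continuous_funpow_quad: "continuous_on UNIV ((quad ^^ n) :: real \<Rightarrow> real)"
proof (induction n)
  case (Suc n)
  have "continuous_on UNIV (quad :: real \<Rightarrow> real)"
    unfolding quad_def by (intro continuous_intros)
  then show ?case using Suc
    by (auto simp: o_def intro: continuous_on_compose2)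
qed (simp add: continuous_on_id id_def)

lemma closed_quad_trapped: "closed {x::real. (quad ^^ n) x \<in> {-2..6}}"
  using continuous_closed_vimage[of "{-2..6::real}" "quad ^^ n"]
    continuous_funpow_quad[of n] by (simp add: vimage_def continuous_on_eq_continuous_at)

lemma closed_julia: "closed julia"
  unfolding julia_def Collect_all_eq using closed_quad_trapped by (intro closed_INT) auto

lemma julia_inside: "julia \<subseteq> {-2..6}"
  unfolding julia_def by (metis (mono_tags, lifting) funpow_0 mem_Collect_eq subsetI)

lemma funpow_quad_mem_julia: "x \<in> julia \<Longrightarrow> (quad ^^ n) x \<in> julia"
  by (simp add: julia_def funpow_add[THEN fun_cong, unfolded o_apply, symmetric] del: atLeastAtMost_iff)

lemma mem_julia_of_funpow:
  assumes "(quad ^^ n) x \<in> julia"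
  shows "x \<in> julia"
proof -
  have "(quad ^^ m) x \<in> {-2..6}" for m
  proof (rule funpow_quad_inside)
    have "(quad ^^ m) ((quad ^^ n) x) \<in> {-2..6}" using assms by (auto simp: julia_def)
    then show "(quad ^^ (m + n)) x \<in> {-2..6}" by (simp add: funpow_add)
  qed simp
  then show ?thesis by (simp add: julia_def)
qed

lemma endpoints_mem_julia: "6 \<in> julia" "-2 \<in> julia"
proof -
  have "(quad ^^ n) (6::real) = 6" for n by (induction n) (auto simp: quad_def)
  then show 6: "6 \<in> julia" by (simp add: julia_def)
  show "-2 \<in> julia" by (rule mem_julia_of_funpow[of 1]) (use 6 in \<open>simp add: quad_def\<close>)
qed

text \<open>All levels from n on lie in the closed set of points still in [-2,6] at time n, and the
  levels below n are finite, so an escaping point cannot be a new limit. Conversely, pulling 4 back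
  along the orbit of a Julia point gives level points converging to it.\<close>

lemma closure_levels: "closure (\<Union>n. level n) = (\<Union>n. level n) \<union> julia"
proof (intro equalityI subsetI)
  fix x assume x: "x \<in> closure (\<Union>n. level n)"
  show "x \<in> (\<Union>n. level n) \<union> julia"
  proof (rule ccontr)
    assume no: "x \<notin> (\<Union>n. level n) \<union> julia"
    then obtain n where n: "(quad ^^ n) x \<notin> {-2..6}" by (auto simp: julia_def)
    have "level m \<subseteq> (\<Union>m<n. level m) \<union> {x. (quad ^^ n) x \<in> {-2..6}}" for m
    proof (cases "m < n")
      case False
      then show ?thesis using funpow_quad_inside[of m _ n] by (auto simp: level_def)
    qed auto
    then have "closure (\<Union>m. level m) \<subseteq> (\<Union>m<n. level m) \<union> {x. (quad ^^ n) x \<in> {-2..6}}"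
      by (intro closure_minimal closed_Un closed_quad_trapped finite_imp_closed)
         (auto simp: finite_level)
    with x n no show False by auto
  qed
next
  fix x assume "x \<in> (\<Union>n. level n) \<union> julia"
  then show "x \<in> closure (\<Union>n. level n)"
  proof
    assume x: "x \<in> julia"
    show ?thesis unfolding closure_approachable
    proof (intro allI impI)
      fix e :: real assume "e > 0"
      from order_tendstoD(2)[OF eight_div_power_tendsto this]
      obtain n where n: "8 / 5 ^ n < e" by (auto simp: eventually_sequentially)
      have "(quad ^^ n) x \<in> {-2..6}" using x by (auto simp: julia_def)
      from quad_pullback[OF this, of 4] obtain x' where "(quad ^^ n) x' = 4" "\<bar>x' - x\<bar> \<le> 8 / 5 ^ n"
        by auto
      with n show "\<exists>y\<in>\<Union>n. level n. dist y x < e"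
        by (intro bexI[of _ x']) (auto simp: level_def dist_real_def)
    qed
  qed (rule subsetD[OF closure_subset])
qed

lemma julia_perfect:
  assumes "x \<in> julia"
  shows "x islimpt julia"
  unfolding islimpt_approachable
proof (intro allI impI)
  fix e :: real assume "e > 0"
  from order_tendstoD(2)[OF eight_div_power_tendsto this]
  obtain n where n: "8 / 5 ^ n < e" by (auto simp: eventually_sequentially)
  \<comment> \<open>A Julia target different from the n-th iterate of x makes the pullback a Julia
    point different from x.\<close>
  define t :: real where "t = (if (quad ^^ n) x = 6 then -2 else 6)"
  have t: "t \<in> julia" "t \<noteq> (quad ^^ n) x" "t \<in> {-2..6}"
    by (auto simp: t_def endpoints_mem_julia)
  have "(quad ^^ n) x \<in> {-2..6}" using assms by (auto simp: julia_def)
  from quad_pullback[OF this t(3)] obtain x' where x': "(quad ^^ n) x' = t" "\<bar>x' - x\<bar> \<le> 8 / 5 ^ n"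
    by auto
  then have "x' \<in> julia" "x' \<noteq> x" using t mem_julia_of_funpow[of n x'] by auto
  then show "\<exists>x'\<in>julia. x' \<noteq> x \<and> dist x' x < e"
    using x' n by (intro bexI[of _ x']) (auto simp: dist_real_def)
qed

text \<open>The 2^n intervals of length 16/5^n centred at the points of level n cover the set, and
  their total length 16 (2/5)^n tends to 0.\<close>

lemma julia_null: "julia \<in> null_sets lborel"
proof -
  have meas: "julia \<in> sets lborel" using closed_julia by auto
  have bound: "emeasure lborel julia \<le> ennreal (16 * (2/5) ^ n)" for n
  proof -
    have "julia \<subseteq> (\<Union>c\<in>level n. {c - 8 / 5 ^ n .. c + 8 / 5 ^ n})"
    proof
      fix x assume "x \<in> julia"
      then have "(quad ^^ n) x \<in> {-2..6}" by (auto simp: julia_def)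
      from quad_pullback[OF this, of 4] obtain x' where "(quad ^^ n) x' = 4" "\<bar>x' - x\<bar> \<le> 8 / 5 ^ n"
        by auto
      then show "x \<in> (\<Union>c\<in>level n. {c - 8 / 5 ^ n .. c + 8 / 5 ^ n})"
        by (intro UN_I[of x']) (auto simp: level_def)
    qed
    then have "emeasure lborel julia \<le> emeasure lborel (\<Union>c\<in>level n. {c - 8 / 5 ^ n .. c + 8 / 5 ^ n})"
      by (intro emeasure_mono) (auto simp: finite_level intro!: borel_closed closed_UN)
    also have "\<dots> \<le> (\<Sum>c\<in>level n. emeasure lborel {c - 8 / 5 ^ n .. c + 8 / 5 ^ n})"
      by (rule emeasure_subadditive_finite) (auto simp: finite_level)
    also have "\<dots> = (\<Sum>c\<in>level n. ennreal (16 / 5 ^ n))"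
      by (intro sum.cong refl) simp
    also have "\<dots> = of_nat (2 ^ n) * ennreal (16 / 5 ^ n)"
      by (simp add: card_level)
    also have "\<dots> = ennreal (16 * (2/5) ^ n)"
      by (simp add: ennreal_of_nat_eq_real_of_nat power_divide flip: ennreal_mult)
    finally show ?thesis .
  qed
  have "(\<lambda>n. 16 * (2/5) ^ n :: real) \<longlonglongrightarrow> 16 * 0"
    by (intro tendsto_intros LIMSEQ_power_zero) simp
  then have "(\<lambda>n. ennreal (16 * (2/5) ^ n)) \<longlonglongrightarrow> ennreal 0"
    by (intro tendsto_ennrealI) simp
  then have "emeasure lborel julia \<le> 0"
    using bound by (intro Lim_bounded2[of _ _ 0]) auto
  with meas show ?thesis by (auto simp: null_sets_def)
qed

lemma cantor_julia: "cantor_set julia"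
  unfolding cantor_set_def
proof (intro conjI ballI allI impI)
  show "julia \<noteq> {}" using endpoints_mem_julia by auto
  show "compact julia"
    using closed_julia julia_inside bounded_subset[OF bounded_closed_interval] by (auto simp: compact_eq_bounded_closed)
  show "x islimpt julia" if "x \<in> julia" for x using julia_perfect that .
  fix T assume T: "T \<subseteq> julia" "connected T"
  show "\<exists>a. T \<subseteq> {a}"
  proof (rule ccontr)
    assume "\<not> (\<exists>a. T \<subseteq> {a})"
    then obtain a b where ab: "a \<in> T" "b \<in> T" "a < b"
      by (metis insertI1 linorder_neqE singletonD subsetI)
    \<comment> \<open>Total disconnectedness follows from measure zero: a nondegenerate interval is
      not a null set.\<close>
    then have "{a..b} \<subseteq> julia" using T connected_contains_Icc by blast
    then have "{a..b} \<in> null_sets lborel" using null_sets_subset[OF julia_null] by auto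
    with ab show False by (auto simp: null_sets_def)
  qed
qed

lemma julia_symmetric: "x \<in> julia \<Longrightarrow> 4 - x \<in> julia"
proof (rule mem_julia_of_funpow[of 1])
  assume "x \<in> julia"
  moreover have "quad (4 - x) = quad x" by (simp add: quad_shift power2_eq_square algebra_simps)
  ultimately show "(quad ^^ 1) (4 - x) \<in> julia" using funpow_quad_mem_julia[of x 1] by simp
qed

lemma level_isolated:
  assumes "x \<in> level n"
  shows "x isolated_in ((\<Union>n. level n) \<union> julia)"
proof -
  define F where "F = (\<Union>m\<le>n. level m) - {x}"
  have F: "closed F" by (auto simp: F_def finite_level intro!: finite_imp_closed)
  \<comment> \<open>At time n + 1 exactly the levels up to n have left [-2,6]; later levels and the
    Julia set are still inside. \<open>F\<close> then removes the finitely many competitors of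
    x.\<close>
  define T where "T = - F \<inter> - {x. (quad ^^ Suc n) x \<in> {-2..6}}"
  have "open T" unfolding T_def
    using F closed_quad_trapped by (intro open_Int) (simp_all only: closed_def double_complement)
  moreover have "T \<inter> ((\<Union>n. level n) \<union> julia) = {x}"
  proof (intro equalityI subsetI)
    fix y assume y: "y \<in> T \<inter> ((\<Union>n. level n) \<union> julia)"
    then have out: "(quad ^^ Suc n) y \<notin> {-2..6}" and F': "y \<notin> F" by (auto simp: T_def)
    then have "y \<notin> julia" unfolding julia_def by blast
    then obtain m where m: "y \<in> level m" using y by auto
    have "m \<le> n"
    proof (rule ccontr)
      assume "\<not> m \<le> n"
      then have "(quad ^^ Suc n) y \<in> {-2..6}"
        using m funpow_quad_inside[of m y "Suc n"] by (auto simp: level_def)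
      with out show False by simp
    qed
    with m F' show "y \<in> {x}" by (auto simp: F_def)
  next
    fix y assume "y \<in> {x}"
    then show "y \<in> T \<inter> ((\<Union>n. level n) \<union> julia)"
      using assms funpow_quad_level[OF assms, of "Suc n"] by (auto simp: T_def F_def)
  qed
  ultimately show ?thesis using assms unfolding isolated_in_def by blast
qed

section \<open>Escape of complex orbits\<close>

lemma quad_growth_outside:
  fixes z :: complex
  shows "cmod (quad z - 2) - 4 \<ge> (cmod (z - 2))\<^sup>2 - 16"
proof -
  have "(cmod (z - 2))\<^sup>2 = cmod ((z - 2)\<^sup>2)" by (simp add: norm_power)
  also have "(z - 2)\<^sup>2 = (quad z - 2) + 12" by (simp add: quad_shift)
  also have "cmod \<dots> \<le> cmod (quad z - 2) + cmod 12" by (rule norm_triangle_ineq)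
  finally show ?thesis by simp
qed

lemma quad_escape:
  fixes z :: complex
  assumes "cmod (z - 2) > 4"
  shows "\<exists>n. cmod ((quad ^^ n) z) > 6"
proof -
  define d where "d = cmod (z - 2) - 4"
  have d: "d > 0" using assms by (simp add: d_def)
  \<comment> \<open>The excess c - 4 becomes at least c^2 - 16 = (c + 4)(c - 4), and c + 4 >=
    8.\<close>
  have grow: "cmod ((quad ^^ n) z - 2) - 4 \<ge> 8 ^ n * d" for n
  proof (induction n)
    case (Suc n)
    define c where "c = cmod ((quad ^^ n) z - 2)"
    have c: "c \<ge> 4" "c - 4 \<ge> 8 ^ n * d" using Suc d by (auto simp: c_def intro: order_trans[rotated])
       (smt (verit, best) mult_pos_pos zero_less_power)
    have "8 ^ Suc n * d \<le> 8 * (c - 4)" using c by simp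
    also have "\<dots> \<le> (c + 4) * (c - 4)" using c by (intro mult_right_mono) auto
    also have "\<dots> = c\<^sup>2 - 16" by (simp add: power2_eq_square algebra_simps)
    also have "\<dots> \<le> cmod ((quad ^^ Suc n) z - 2) - 4"
      using quad_growth_outside[of "(quad ^^ n) z"] by (simp add: c_def)
    finally show ?case .
  qed (simp add: d_def)
  \<comment> \<open>An excess above 4 means distance above 8 from the centre 2, hence modulus above
    6, the threshold of \<open>resolvable_large\<close>.\<close>
  obtain n where n: "4 / d < 8 ^ n" using real_arch_pow[of 8 "4 / d"] by auto
  then have "8 ^ n * d > 4" using d by (simp add: field_simps)
  then have "cmod ((quad ^^ n) z - 2) > 8" using grow[of n] by simp
  moreover have "cmod ((quad ^^ n) z - 2) \<le> cmod ((quad ^^ n) z) + 2"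
    using norm_triangle_ineq4[of "(quad ^^ n) z" 2] by simp
  ultimately show ?thesis by (intro exI[of _ n]) simp
qed

text \<open>Along an orbit staying in the disc of radius 4 about 2, imaginary parts grow at least
  by the factor 5, so the orbit is real.\<close>

lemma trapped_complex_mem_julia:
  fixes z :: complex
  assumes "\<And>n. cmod ((quad ^^ n) z - 2) \<le> 4"
  shows "z \<in> of_real ` julia"
proof -
  \<comment> \<open>With u the offset from 2, the next offset is u^2 - 12; if it is at most 4 in
    modulus, Re (u^2) >= 8. Doubling 5/2 gives the growth factor of Im (u^2) = 2 Re u Im u.\<close>
  have Re_ge: "\<bar>Re u\<bar> \<ge> 5/2" if "cmod (u\<^sup>2 - 12) \<le> 4" for u :: complex
  proof -
    have "\<bar>Re (u\<^sup>2 - 12)\<bar> \<le> 4" using that abs_Re_le_cmod order_trans by blast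
    then have "(Re u)\<^sup>2 - (Im u)\<^sup>2 \<ge> 8" by (simp add: power2_eq_square)
    then have "(Re u)\<^sup>2 \<ge> 8" by (smt (verit) zero_le_power2)
    then have "(Re u)\<^sup>2 \<ge> (5/2)\<^sup>2" by (simp add: power2_eq_square)
    then have "(5/2)\<^sup>2 \<le> \<bar>Re u\<bar>\<^sup>2" by simp
    then show ?thesis by (rule power2_le_imp_le) simp
  qed
  have im: "\<bar>Im ((quad ^^ n) z)\<bar> \<ge> 5 ^ n * \<bar>Im z\<bar>" for n
  proof (induction n)
    case (Suc n)
    define u where "u = (quad ^^ n) z - 2"
    have u: "(quad ^^ Suc n) z - 2 = u\<^sup>2 - 12" by (simp add: u_def quad_shift)
    have "\<bar>Re u\<bar> \<ge> 5/2" using assms[of "Suc n"] unfolding u by (rule Re_ge)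
    then have "5 * \<bar>Im u\<bar> \<le> 2 * \<bar>Re u\<bar> * \<bar>Im u\<bar>" by (intro mult_right_mono) auto
    also have "\<dots> = \<bar>Im (u\<^sup>2 - 12)\<bar>" by (simp add: power2_eq_square abs_mult)
    also have "\<dots> = \<bar>Im ((quad ^^ Suc n) z)\<bar>" by (simp flip: u)
    finally show ?case using Suc by (simp add: u_def)
  qed simp
  have "Im z = 0"
  proof (rule ccontr)
    assume nz: "Im z \<noteq> 0"
    obtain n where n: "4 / \<bar>Im z\<bar> < 5 ^ n" using real_arch_pow[of 5 "4 / \<bar>Im z\<bar>"] by auto
    then have "5 ^ n * \<bar>Im z\<bar> > 4" using nz by (simp add: field_simps)
    moreover have "\<bar>Im ((quad ^^ n) z)\<bar> \<le> 4"
      using abs_Im_le_cmod[of "(quad ^^ n) z - 2"] assms[of n] by simp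
    ultimately show False using im[of n] by simp
  qed
  then have z: "z = of_real (Re z)" by (simp add: complex_eq_iff)
  have "(quad ^^ n) (Re z) \<in> {-2..6}" for n
  proof -
    have "cmod (of_real ((quad ^^ n) (Re z) - 2)) \<le> 4"
      using assms[of n] by (subst (asm) z) (simp only: funpow_quad_of_real of_real_diff of_real_numeral)
    then show ?thesis by (simp only: norm_of_real) auto
  qed
  then show ?thesis using z by (auto simp: julia_def)
qed

lemma escape_or_julia:
  fixes z :: complex
  assumes "z \<notin> of_real ` julia"
  shows "\<exists>n. cmod ((quad ^^ n) z) > 6"
proof -
  obtain n where "cmod ((quad ^^ n) z - 2) > 4"
    using trapped_complex_mem_julia[of z] assms by (meson not_le)
  from quad_escape[OF this] obtain m where "cmod ((quad ^^ m) ((quad ^^ n) z)) > 6" by auto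
  then show ?thesis
    using funpow_add[of m n "quad :: complex \<Rightarrow> complex"] by (intro exI[of _ "m + n"]) simp
qed

text \<open>A factor below $6/5$ is compensated by the next one: points of the Julia set just to
  the right of 4 are mapped to its left half.\<close>

lemma julia_prod_growth:
  assumes "x \<in> julia"
  shows "(\<Prod>k<n. \<bar>(quad ^^ k) x - 4\<bar>) \<ge> 1/2 * (6/5) ^ n"
  using assms
proof (induction n arbitrary: x rule: less_induct)
  case (less n)
  have split: "(\<Prod>k<Suc m. \<bar>(quad ^^ k) x - 4\<bar>) = \<bar>x - 4\<bar> * (\<Prod>k<m. \<bar>(quad ^^ k) (quad x) - 4\<bar>)"
    for m and x :: real
    unfolding prod.lessThan_Suc_shift o_def funpow_Suc_apply funpow_0 by (rule refl)
  \<comment> \<open>The Julia set has a gap around 2 that contains 4, because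
    \<open>quad x >= -2\<close> forces (x - 2)^2 >= 8 > (14/5)^2. So every factor is at least
    4/5.\<close>
  have far: "x \<ge> 24/5 \<or> x \<le> -4/5" if "x \<in> julia" for x
  proof -
    have "quad x \<ge> -2" using funpow_quad_mem_julia[OF that, of 1] julia_inside by auto
    then have "(x - 2)\<^sup>2 \<ge> 8" by (simp add: quad_shift)
    then have "(x - 2)\<^sup>2 \<ge> (14/5)\<^sup>2" by (simp add: power2_eq_square)
    then have "(14/5)\<^sup>2 \<le> \<bar>x - 2\<bar>\<^sup>2" by simp
    then have "\<bar>x - 2\<bar> \<ge> 14/5" by (rule power2_le_imp_le) simp
    then show ?thesis by linarith
  qed
  have qx: "quad x \<in> julia" "quad (quad x) \<in> julia"
    using funpow_quad_mem_julia[OF less.prems, of 1] funpow_quad_mem_julia[OF less.prems, of 2]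
    by (simp_all add: numeral_2_eq_2)
  show ?case
  proof (cases n)
    case 0
    then show ?thesis by simp
  next
    case (Suc m)
    show ?thesis
    proof (cases "\<bar>x - 4\<bar> \<ge> 6/5")
      case True
      have "1/2 * (6/5 :: real) ^ n = (6/5) * (1/2 * (6/5) ^ m)" by (simp add: Suc)
      also have "\<dots> \<le> \<bar>x - 4\<bar> * (\<Prod>k<m. \<bar>(quad ^^ k) (quad x) - 4\<bar>)"
        using less.IH[OF _ qx(1), of m] True Suc by (intro mult_mono) auto
      finally show ?thesis unfolding Suc split .
    next
      case False
      then have x: "x \<ge> 24/5" "x \<le> 26/5" using far[OF less.prems] by auto
      then have "\<bar>x - 2\<bar> \<le> 16/5" by auto
      then have "\<bar>x - 2\<bar>\<^sup>2 \<le> (16/5)\<^sup>2" by (intro power_mono) simp_all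
      then have "(x - 2)\<^sup>2 \<le> (16/5)\<^sup>2" by simp
      then have "quad x \<le> 1" by (simp add: quad_shift power2_eq_square)
      then have qx': "quad x \<le> -4/5" using far[OF qx(1)] by auto
      show ?thesis
      proof (cases m)
        case 0
        \<comment> \<open>The prefactor 1/2 pays for a product that ends in a small factor: 4/5 >=
          1/2 * 6/5.\<close>
        then show ?thesis using x Suc by (simp)
      next
        case (Suc l)
        have n: "n = Suc (Suc l)" using Suc \<open>n = Suc m\<close> by simp
        \<comment> \<open>The next point is at most -4/5, so at distance at least 24/5 from 4, and
          4/5 * 24/5 = 96/25 beats (6/5)^2 = 36/25.\<close>
        have "1/2 * (6/5 :: real) ^ n \<le> (4/5 * (24/5)) * (1/2 * (6/5) ^ l)" 
          using zero_le_power[of "6/5::real" l] by (simp add: n)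
        also have "\<dots> \<le> (\<bar>x - 4\<bar> * \<bar>quad x - 4\<bar>) * (\<Prod>k<l. \<bar>(quad ^^ k) (quad (quad x)) - 4\<bar>)"
          using less.IH[OF _ qx(2), of l] x qx' n by (intro mult_mono) auto
        finally show ?thesis unfolding n split by (simp add: mult.assoc)
      qed
    qed
  qed
qed

section \<open>The Schur complement of the adjacency operator\<close>

definition wcons :: "nat \<Rightarrow> (nat \<Rightarrow> nat) \<Rightarrow> nat \<Rightarrow> nat" (infixr \<open>#\<^sub>w\<close> 65) where
  "x #\<^sub>w v = case_nat x v"

lemma wcons_simps [simp]: "(x #\<^sub>w v) 0 = x" "(x #\<^sub>w v) (Suc k) = v k"
  by (simp_all add: wcons_def)

lemma wcons_eq_iff [simp]: "x #\<^sub>w v = y #\<^sub>w u \<longleftrightarrow> x = y \<and> v = u"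
  by (metis wcons_simps ext)

lemma wcons_collapse: "v 0 #\<^sub>w (\<lambda>k. v (Suc k)) = v"
  by (rule ext) (simp add: wcons_def split: nat.split)

lemma wcons_cases: obtains x u where "v = x #\<^sub>w u"
  using wcons_collapse by metis

lemma map_wcons: "map (x #\<^sub>w v) [0..<Suc k] = x # map v [0..<k]"
proof -
  have "[0..<Suc k] = 0 # map Suc [0..<k]"
    by (simp add: upt_conv_Cons map_Suc_upt del: upt_Suc)
  then show ?thesis by (simp del: upt_Suc)
qed

text \<open>The inverse of e_i, found by reversing each rewriting rule; on infinite words
  \<open>ei_eb\<close> and \<open>eb_ei\<close> confirm it for nonzero i.\<close>

fun eb_fin :: "nat \<Rightarrow> nat list \<Rightarrow> nat list" where
  "eb_fin i [] = []"
| "eb_fin i (x # w) =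
     (if x = i then 0 # eb_fin i w else if x = 0 then i # w else x # w)"

definition eb :: "nat \<Rightarrow> (nat \<Rightarrow> nat) \<Rightarrow> (nat \<Rightarrow> nat)" where
  "eb i w = (\<lambda>k. eb_fin i (map w [0..<Suc k]) ! k)"

lemma ei_wcons:
  "ei i (x #\<^sub>w v) = (if x = 0 then i #\<^sub>w ei i v else if x = i then 0 #\<^sub>w v else x #\<^sub>w v)"
proof
  fix k
  show "ei i (x #\<^sub>w v) k = (if x = 0 then i #\<^sub>w ei i v else if x = i then 0 #\<^sub>w v else x #\<^sub>w v) k"
    by (cases k) (simp_all add: ei_def map_wcons del: upt_Suc)
qed

lemma eb_wcons:
  "eb i (x #\<^sub>w v) = (if x = i then 0 #\<^sub>w eb i v else if x = 0 then i #\<^sub>w v else x #\<^sub>w v)"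
proof
  fix k
  show "eb i (x #\<^sub>w v) k = (if x = i then 0 #\<^sub>w eb i v else if x = 0 then i #\<^sub>w v else x #\<^sub>w v) k"
    by (cases k) (simp_all add: eb_def map_wcons del: upt_Suc)
qed

text \<open>Infinite words admit no structural induction, so equality is checked letter by letter:
  induct on the position and peel off the first letter.\<close>

lemma ei_eb:
  assumes "i \<noteq> 0"
  shows "ei i (eb i v) = v"
proof
  fix k
  show "ei i (eb i v) k = v k"
  proof (induction k arbitrary: v)
    case 0
    obtain x u where "v = x #\<^sub>w u" by (rule wcons_cases)
    then show ?case using assms by (simp add: ei_wcons eb_wcons)
  next
    case (Suc k)
    obtain x u where "v = x #\<^sub>w u" by (rule wcons_cases)
    then show ?case using assms Suc by (simp add: ei_wcons eb_wcons)
  qed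
qed

lemma eb_ei:
  assumes "i \<noteq> 0"
  shows "eb i (ei i v) = v"
proof
  fix k
  show "eb i (ei i v) k = v k"
  proof (induction k arbitrary: v)
    case 0
    obtain x u where "v = x #\<^sub>w u" by (rule wcons_cases)
    then show ?case using assms by (simp add: ei_wcons eb_wcons)
  next
    case (Suc k)
    obtain x u where "v = x #\<^sub>w u" by (rule wcons_cases)
    then show ?case using assms Suc by (simp add: ei_wcons eb_wcons)
  qed
qed

lemma wcons_mem_Xinf: "x #\<^sub>w v \<in> Xinf \<longleftrightarrow> x < 4 \<and> v \<in> Xinf"
  unfolding Xinf_def by (auto simp: wcons_def split: nat.splits)

lemma ei_mem_Xinf:
  assumes "v \<in> Xinf" "i < 4"
  shows "ei i v \<in> Xinf"
proof -
  have "ei i v k < 4" for k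
    using assms(1)
  proof (induction k arbitrary: v)
    case 0
    obtain x u where "v = x #\<^sub>w u" by (rule wcons_cases)
    then show ?case using assms(2) 0 by (simp add: ei_wcons wcons_mem_Xinf)
  next
    case (Suc k)
    obtain x u where v: "v = x #\<^sub>w u" by (rule wcons_cases)
    then have "u \<in> Xinf" using Suc by (simp add: wcons_mem_Xinf)
    then show ?case using v Suc(1)[of u] by (simp add: ei_wcons Xinf_def)
  qed
  then show ?thesis by (simp add: Xinf_def)
qed

lemma eb_mem_Xinf:
  assumes "v \<in> Xinf" "i < 4"
  shows "eb i v \<in> Xinf"
proof -
  have "eb i v k < 4" for k
    using assms(1)
  proof (induction k arbitrary: v)
    case 0
    obtain x u where "v = x #\<^sub>w u" by (rule wcons_cases)
    then show ?case using assms(2) 0 by (simp add: eb_wcons wcons_mem_Xinf)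
  next
    case (Suc k)
    obtain x u where v: "v = x #\<^sub>w u" by (rule wcons_cases)
    then have "u \<in> Xinf" using Suc by (simp add: wcons_mem_Xinf)
    then show ?case using v Suc(1)[of u] by (simp add: eb_wcons Xinf_def)
  qed
  then show ?thesis by (simp add: Xinf_def)
qed

text \<open>Stands in for an orbit. Unlike being an orbit, this property passes to
  \<open>tail V\<close> immediately, and the equivalence includes stability under the inverse
  generators.\<close>

definition invariant :: "(nat \<Rightarrow> nat) set \<Rightarrow> bool" where
  "invariant V \<longleftrightarrow> V \<noteq> {} \<and> V \<subseteq> Xinf \<and> (\<forall>i\<in>{1,2,3}. \<forall>v. ei i v \<in> V \<longleftrightarrow> v \<in> V)"

lemma invariant_ei: "invariant V \<Longrightarrow> i \<in> {1,2,3} \<Longrightarrow> ei i v \<in> V \<longleftrightarrow> v \<in> V"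
  by (auto simp: invariant_def)

lemma invariant_eb: "invariant V \<Longrightarrow> i \<in> {1,2,3} \<Longrightarrow> eb i v \<in> V \<longleftrightarrow> v \<in> V"
  using invariant_ei[of V i "eb i v"] ei_eb[of i v] by auto

lemma invariant_orbit:
  assumes "w \<in> Xinf"
  shows "invariant (orbit w)"
  unfolding invariant_def
proof (intro conjI ballI allI)
  show "orbit w \<noteq> {}" using orbit.base by auto
  show sub: "orbit w \<subseteq> Xinf"
  proof
    fix v assume "v \<in> orbit w"
    then show "v \<in> Xinf" by induction (use assms ei_mem_Xinf in auto)
  qed
  fix i v assume i: "i \<in> {1, 2, 3 :: nat}"
  show "ei i v \<in> orbit w \<longleftrightarrow> v \<in> orbit w"
  proof
    assume ov: "ei i v \<in> orbit w"
    then have "eb i (ei i v) \<in> Xinf" using sub i by (intro eb_mem_Xinf) auto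
    moreover have "eb i (ei i v) = v" by (rule eb_ei) (use i in auto)
    ultimately show "v \<in> orbit w" using orbit.bwd[OF ov i] by simp
  qed (use i orbit.fwd in auto)
qed

section \<open>The adjacency operator on square summable functions\<close>

definition adj :: "((nat \<Rightarrow> nat) \<Rightarrow> complex) \<Rightarrow> (nat \<Rightarrow> nat) \<Rightarrow> complex" where
  "adj f v = (\<Sum>i\<in>{1,2,3}. f (ei i v) + f (eb i v))"

lemma adj_outside:
  assumes "invariant V" "\<And>v. v \<notin> V \<Longrightarrow> f v = 0" "v \<notin> V"
  shows "adj f v = 0"
  unfolding adj_def using assms invariant_ei[OF assms(1)] invariant_eb[OF assms(1)]
  by (intro sum.neutral) auto

text \<open>The fibre of \<open>ei i\<close> over v is the single point \<open>eb i v\<close>, so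
  \<open>infsum\<close> collapses. As \<open>adj\<close> does not mention V, later identities hold
  for arbitrary functions.\<close>

lemma adj_op_eq_adj:
  assumes "invariant V" "f \<in> l2 V"
  shows "adj_op V f = adj f"
proof
  fix v
  show "adj_op V f v = adj f v"
  proof (cases "v \<in> V")
    case True
    have "infsum f {u \<in> V. ei i u = v} = f (eb i v)" if i: "i \<in> {1,2,3}" for i
    proof -
      have "i \<noteq> 0" using i by auto
      then have "{u \<in> V. ei i u = v} = {eb i v}"
        using ei_eb[of i] eb_ei[of i] invariant_eb[OF assms(1) i, of v] True by auto
      then show ?thesis by simp
    qed
    then show ?thesis using True unfolding adj_op_def adj_def by (simp cong: sum.cong)
  next
    case False
    then show ?thesis
      using adj_outside[OF assms(1), of f v] assms(2) by (auto simp: adj_op_def l2_def)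
  qed
qed

text \<open>A norm bound stated through finite subsets, so that the triangle inequality, scaling and
  reindexing come from \<open>L2_set\<close>.\<close>

definition l2_le :: "'a set \<Rightarrow> ('a \<Rightarrow> complex) \<Rightarrow> real \<Rightarrow> bool" where
  "l2_le V f B \<longleftrightarrow> (\<forall>F. finite F \<and> F \<subseteq> V \<longrightarrow> L2_set (\<lambda>v. cmod (f v)) F \<le> B)"

lemma l2_leD: "l2_le V f B \<Longrightarrow> finite F \<Longrightarrow> F \<subseteq> V \<Longrightarrow> L2_set (\<lambda>v. cmod (f v)) F \<le> B"
  by (auto simp: l2_le_def)

lemma l2_le_nonneg: "l2_le V f B \<Longrightarrow> 0 \<le> B"
  using l2_leD[of V f B "{}"] by simp

lemma l2_le_pointwise: "l2_le V f B \<Longrightarrow> v \<in> V \<Longrightarrow> cmod (f v) \<le> B"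
  using l2_leD[of V f B "{v}"] by (simp add: L2_set_def)

lemma mem_l2_iff: "f \<in> l2 V \<longleftrightarrow> (\<forall>v. v \<notin> V \<longrightarrow> f v = 0) \<and> (\<exists>B. l2_le V f B)"
proof -
  have "(\<lambda>v. (cmod (f v))\<^sup>2) summable_on V \<longleftrightarrow> (\<exists>B. l2_le V f B)"
  proof
    assume s: "(\<lambda>v. (cmod (f v))\<^sup>2) summable_on V"
    have "l2_le V f (sqrt (\<Sum>\<^sub>\<infinity>v\<in>V. (cmod (f v))\<^sup>2))"
      unfolding l2_le_def L2_set_def
      by (auto intro!: real_sqrt_le_mono finite_sum_le_infsum[OF s])
    then show "\<exists>B. l2_le V f B" ..
  next
    assume "\<exists>B. l2_le V f B"
    then obtain B where B: "l2_le V f B" ..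
    show "(\<lambda>v. (cmod (f v))\<^sup>2) summable_on V"
    proof (rule nonneg_bdd_above_summable_on)
      show "bdd_above (sum (\<lambda>v. (cmod (f v))\<^sup>2) ` {F. F \<subseteq> V \<and> finite F})"
      proof (rule bdd_aboveI2)
        fix F assume "F \<in> {F. F \<subseteq> V \<and> finite F}"
        then have "L2_set (\<lambda>v. cmod (f v)) F \<le> B" using l2_leD[OF B] by auto
        then show "(\<Sum>v\<in>F. (cmod (f v))\<^sup>2) \<le> B\<^sup>2"
          unfolding L2_set_def by (rule sqrt_le_D)
      qed
    qed simp
  qed
  then show ?thesis by (auto simp: l2_def)
qed

lemma l2_outside: "f \<in> l2 V \<Longrightarrow> v \<notin> V \<Longrightarrow> f v = 0"
  by (auto simp: l2_def)

lemma l2_le_add: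
  assumes "l2_le V f A" "l2_le V g B"
  shows "l2_le V (\<lambda>v. f v + g v) (A + B)"
  unfolding l2_le_def
proof (intro allI impI)
  fix F assume F: "finite F \<and> F \<subseteq> V"
  have "L2_set (\<lambda>v. cmod (f v + g v)) F \<le> L2_set (\<lambda>v. cmod (f v) + cmod (g v)) F"
    by (rule L2_set_mono) (auto intro: norm_triangle_ineq)
  also have "\<dots> \<le> L2_set (\<lambda>v. cmod (f v)) F + L2_set (\<lambda>v. cmod (g v)) F"
    by (rule L2_set_triangle_ineq)
  also have "\<dots> \<le> A + B" using assms F by (intro add_mono l2_leD) auto
  finally show "L2_set (\<lambda>v. cmod (f v + g v)) F \<le> A + B" .
qed

lemma l2_le_cmult:
  assumes "l2_le V f B"
  shows "l2_le V (\<lambda>v. c * f v) (cmod c * B)"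
  unfolding l2_le_def norm_mult using l2_leD[OF assms]
  by (auto simp: L2_set_left_distrib[symmetric] L2_set_right_distrib[symmetric] intro!: mult_left_mono)

lemma l2_le_zero: "l2_le V (\<lambda>_. 0) 0"
  by (simp add: l2_le_def L2_set_def)

lemma l2_le_comp:
  assumes "l2_le W f B" "inj_on h V" "h ` V \<subseteq> W"
  shows "l2_le V (\<lambda>v. f (h v)) B"
  unfolding l2_le_def
proof (intro allI impI)
  fix F assume F: "finite F \<and> F \<subseteq> V"
  have "L2_set (\<lambda>v. cmod (f (h v))) F = L2_set (\<lambda>v. cmod (f v)) (h ` F)"
    unfolding L2_set_def using inj_on_subset[OF assms(2)] F
    by (subst sum.reindex) (auto simp: o_def)
  also have "\<dots> \<le> B" using F assms(3) by (intro l2_leD[OF assms(1)]) auto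
  finally show "L2_set (\<lambda>v. cmod (f (h v))) F \<le> B" .
qed

lemma l2_add: "f \<in> l2 V \<Longrightarrow> g \<in> l2 V \<Longrightarrow> (\<lambda>v. f v + g v) \<in> l2 V"
  unfolding mem_l2_iff using l2_le_add by fastforce

lemma l2_cmult: "f \<in> l2 V \<Longrightarrow> (\<lambda>v. c * f v) \<in> l2 V"
  unfolding mem_l2_iff using l2_le_cmult by fastforce

lemma l2_zero: "(\<lambda>_. 0) \<in> l2 V"
  unfolding mem_l2_iff using l2_le_zero by auto

lemma l2_diff: "f \<in> l2 V \<Longrightarrow> g \<in> l2 V \<Longrightarrow> (\<lambda>v. f v - g v) \<in> l2 V"
  using l2_add[of f V "\<lambda>v. (-1) * g v"] l2_cmult[of g V "-1"] by simp

lemma l2_sum: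
  assumes "finite J" "\<And>j. j \<in> J \<Longrightarrow> f j \<in> l2 V"
  shows "(\<lambda>v. \<Sum>j\<in>J. f j v) \<in> l2 V"
  using assms by (induction J rule: finite_induct) (auto intro: l2_add l2_zero)

lemma l2_comp:
  assumes "f \<in> l2 W" "inj h" "\<And>v. h v \<in> W \<longleftrightarrow> v \<in> V"
  shows "(\<lambda>v. f (h v)) \<in> l2 V"
proof -
  obtain B where "l2_le W f B" using assms(1) by (auto simp: mem_l2_iff)
  then have "l2_le V (\<lambda>v. f (h v)) B"
    by (rule l2_le_comp) (use assms inj_on_subset[OF assms(2)] in auto)
  then show ?thesis using assms by (auto simp: mem_l2_iff)
qed

lemma inj_ei: "i \<noteq> 0 \<Longrightarrow> inj (ei i)"
  using inj_on_inverseI[of UNIV "eb i" "ei i"] eb_ei by simp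

lemma inj_eb: "i \<noteq> 0 \<Longrightarrow> inj (eb i)"
  using inj_on_inverseI[of UNIV "ei i" "eb i"] ei_eb by simp

lemma l2_ei: "invariant V \<Longrightarrow> i \<in> {1,2,3} \<Longrightarrow> f \<in> l2 V \<Longrightarrow> (\<lambda>v. f (ei i v)) \<in> l2 V"
  by (rule l2_comp[where W = V and h = "ei i"]) (auto intro!: inj_ei simp: invariant_ei)

lemma l2_eb: "invariant V \<Longrightarrow> i \<in> {1,2,3} \<Longrightarrow> f \<in> l2 V \<Longrightarrow> (\<lambda>v. f (eb i v)) \<in> l2 V"
  by (rule l2_comp[where W = V and h = "eb i"]) (auto intro!: inj_eb simp: invariant_eb)

lemma l2_adj: "invariant V \<Longrightarrow> f \<in> l2 V \<Longrightarrow> adj f \<in> l2 V"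
  unfolding adj_def by (intro l2_sum l2_add l2_ei l2_eb) auto

text \<open>Six compositions with injections, none increasing the norm: the origin of the threshold
  6.\<close>

lemma l2_le_adj:
  assumes V: "invariant V" and f: "l2_le V f B"
  shows "l2_le V (adj f) (6 * B)"
proof -
  have *: "l2_le V (\<lambda>v. f (ei i v) + f (eb i v)) (B + B)" if i: "i \<in> {1,2,3}" for i
  proof (rule l2_le_add)
    have i0: "i \<noteq> 0" using i by auto
    show "l2_le V (\<lambda>v. f (ei i v)) B"
      using f by (rule l2_le_comp)
        (use inj_ei[OF i0] inj_on_subset invariant_ei[OF V i] in auto)
    show "l2_le V (\<lambda>v. f (eb i v)) B"
      using f by (rule l2_le_comp)
        (use inj_eb[OF i0] inj_on_subset invariant_eb[OF V i] in auto)
  qed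
  have "l2_le V (\<lambda>v. (f (ei 1 v) + f (eb 1 v)) + ((f (ei 2 v) + f (eb 2 v)) + (f (ei 3 v) + f (eb 3 v))))
     ((B + B) + ((B + B) + (B + B)))"
    by (intro l2_le_add[of V "\<lambda>v. f (ei _ v) + f (eb _ v)"] l2_le_add[of V "\<lambda>v. f (ei _ v) + f (eb _ v)" _ "\<lambda>v. f (ei _ v) + f (eb _ v)"] *) auto
  then show ?thesis by (simp add: adj_def[abs_def] algebra_simps)
qed

section \<open>Decomposition by the first letter\<close>

definition tail :: "(nat \<Rightarrow> nat) set \<Rightarrow> (nat \<Rightarrow> nat) set" where
  "tail V = {v. 0 #\<^sub>w v \<in> V}"

text \<open>The rule e_i(i v) = 0 v trades the letter i for 0 without touching v, so V consists of
  four copies of \<open>tail V\<close>.\<close>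

lemma wcons_mem_iff_tail:
  assumes "invariant V" "x < 4"
  shows "x #\<^sub>w v \<in> V \<longleftrightarrow> v \<in> tail V"
proof (cases "x = 0")
  case False
  then have "x \<in> {1,2,3}" using assms(2) by auto
  from invariant_ei[OF assms(1) this, of "x #\<^sub>w v"] False show ?thesis
    by (simp add: ei_wcons tail_def)
qed (simp add: tail_def)

lemma invariant_tail:
  assumes V: "invariant V"
  shows "invariant (tail V)"
  unfolding invariant_def
proof (intro conjI ballI allI)
  obtain u where u: "u \<in> V" using V by (auto simp: invariant_def)
  obtain x v where "u = x #\<^sub>w v" by (rule wcons_cases)
  then show "tail V \<noteq> {}" using u V wcons_mem_iff_tail[OF V, of x v]
    by (auto simp: invariant_def wcons_mem_Xinf)
  show "tail V \<subseteq> Xinf" using V by (auto simp: tail_def invariant_def wcons_mem_Xinf)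
  fix i v assume i: "i \<in> {1,2,3::nat}"
  have "v \<in> tail V \<longleftrightarrow> ei i (0 #\<^sub>w v) \<in> V"
    unfolding invariant_ei[OF V i] by (simp add: tail_def)
  also have "\<dots> \<longleftrightarrow> ei i v \<in> tail V"
    using i by (auto simp: ei_wcons wcons_mem_iff_tail[OF V])
  finally show "ei i v \<in> tail V \<longleftrightarrow> v \<in> tail V" ..
qed

lemma invariant_cases:
  assumes "invariant V" "u \<in> V"
  obtains x v where "u = x #\<^sub>w v" "x < 4" "v \<in> tail V"
proof -
  obtain x v where u: "u = x #\<^sub>w v" by (rule wcons_cases)
  then have "x < 4" using assms by (auto simp: invariant_def wcons_mem_Xinf)
  then show ?thesis using that u assms wcons_mem_iff_tail by blast
qed

lemma l2_wcons:
  assumes "invariant V" "f \<in> l2 V" "x < 4"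
  shows "(\<lambda>v. f (x #\<^sub>w v)) \<in> l2 (tail V)"
  using assms(2) by (rule l2_comp) (auto simp: inj_def wcons_mem_iff_tail[OF assms(1,3)])

text \<open>Assembles a function on V from its four blocks; the form as a sum lets
  \<open>l2_sum\<close> treat the blocks separately.\<close>

definition glue :: "(nat \<Rightarrow> (nat \<Rightarrow> nat) \<Rightarrow> complex) \<Rightarrow> (nat \<Rightarrow> nat) \<Rightarrow> complex" where
  "glue F u = (\<Sum>x<4. if u 0 = x then F x (\<lambda>k. u (Suc k)) else 0)"

lemma glue_wcons: "x < 4 \<Longrightarrow> glue F (x #\<^sub>w v) = F x v"
  unfolding glue_def by (subst sum.delta') auto

lemma l2_glue:
  assumes V: "invariant V" and F: "\<And>x. x < 4 \<Longrightarrow> F x \<in> l2 (tail V)"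
  shows "glue F \<in> l2 V"
  unfolding glue_def
proof (rule l2_sum)
  fix x :: nat assume "x \<in> {..<4}"
  then have x: "x < 4" by simp
  let ?f = "\<lambda>u. if u 0 = x then F x (\<lambda>k. u (Suc k)) else 0"
  obtain B where B: "l2_le (tail V) (F x) B" using F[OF x] by (auto simp: mem_l2_iff)
  have "l2_le V ?f B"
    unfolding l2_le_def
  proof (intro allI impI)
    fix S assume S: "finite S \<and> S \<subseteq> V"
    define S' where "S' = {v. x #\<^sub>w v \<in> S}"
    have im: "(#\<^sub>w) x ` S' = {u \<in> S. u 0 = x}"
    proof (intro equalityI subsetI)
      fix u assume u: "u \<in> {u \<in> S. u 0 = x}"
      then have "u = x #\<^sub>w (\<lambda>k. u (Suc k))" using wcons_collapse[of u] by simp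
      then show "u \<in> (#\<^sub>w) x ` S'" using u by (auto simp: S'_def)
    qed (auto simp: S'_def)
    have fin: "finite S'"
      using S by (intro finite_imageD[of "(#\<^sub>w) x" S', unfolded im]) (auto simp: inj_on_def)
    have "(\<Sum>u\<in>S. (cmod (?f u))\<^sup>2) = (\<Sum>u\<in>{u \<in> S. u 0 = x}. (cmod (?f u))\<^sup>2)"
      using S by (intro sum.mono_neutral_right) auto
    also have "\<dots> = (\<Sum>v\<in>S'. (cmod (F x v))\<^sup>2)"
      unfolding im[symmetric] by (subst sum.reindex) (auto simp: inj_on_def)
    finally have "L2_set (\<lambda>u. cmod (?f u)) S = L2_set (\<lambda>v. cmod (F x v)) S'"
      by (simp add: L2_set_def)
    also have "\<dots> \<le> B"
      using fin S wcons_mem_iff_tail[OF V x] by (intro l2_leD[OF B]) (auto simp: S'_def)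
    finally show "L2_set (\<lambda>u. cmod (?f u)) S \<le> B" .
  qed
  moreover have "?f u = 0" if "u \<notin> V" for u
    using that wcons_mem_iff_tail[OF V x, of "\<lambda>k. u (Suc k)"] wcons_collapse[of u]
      l2_outside[OF F[OF x]] by auto
  ultimately show "?f \<in> l2 V" unfolding mem_l2_iff by blast
qed simp

text \<open>Bijectivity as unique solvability, because the reduction transports individual equations
  and their solutions.\<close>

definition resolvable :: "(nat \<Rightarrow> nat) set \<Rightarrow> complex \<Rightarrow> bool" where
  "resolvable V z \<longleftrightarrow> (\<forall>g\<in>l2 V. \<exists>!f. f \<in> l2 V \<and> (\<forall>v. adj f v - z * f v = g v))"

lemma op_spectrum_iff:
  assumes V: "invariant V"
  shows "z \<in> op_spectrum V (adj_op V) \<longleftrightarrow> \<not> resolvable V z"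
proof -
  define T where "T = (\<lambda>f v. adj_op V f v - z * f v)"
  have T: "T f = (\<lambda>v. adj f v - z * f v)" if "f \<in> l2 V" for f
    using adj_op_eq_adj[OF V that] by (simp add: T_def)
  have maps: "T f \<in> l2 V" if "f \<in> l2 V" for f
    unfolding T[OF that] by (intro l2_diff l2_adj l2_cmult V that)
  have "bij_betw T (l2 V) (l2 V) \<longleftrightarrow> (\<forall>g\<in>l2 V. \<exists>!f. f \<in> l2 V \<and> T f = g)"
  proof
    assume b: "bij_betw T (l2 V) (l2 V)"
    show "\<forall>g\<in>l2 V. \<exists>!f. f \<in> l2 V \<and> T f = g"
    proof
      fix g assume "g \<in> l2 V"
      then have "g \<in> T ` l2 V" using bij_betw_imp_surj_on[OF b] by simp
      then obtain f where f: "f \<in> l2 V" "T f = g" by auto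
      show "\<exists>!f. f \<in> l2 V \<and> T f = g"
        using f inj_onD[OF bij_betw_imp_inj_on[OF b]] by (intro ex1I[of _ f]) auto
    qed
  next
    assume u: "\<forall>g\<in>l2 V. \<exists>!f. f \<in> l2 V \<and> T f = g"
    show "bij_betw T (l2 V) (l2 V)"
      unfolding bij_betw_def
    proof (intro conjI equalityI subsetI)
      show "inj_on T (l2 V)"
      proof (rule inj_onI)
        fix f f' assume f: "f \<in> l2 V" "f' \<in> l2 V" "T f = T f'"
        from bspec[OF u maps[OF f(1)]] f show "f = f'" by metis
      qed
      fix g assume "g \<in> l2 V"
      from bspec[OF u this] show "g \<in> T ` l2 V" by auto
    qed (use maps in auto)
  qed
  also have "\<dots> \<longleftrightarrow> resolvable V z"
    unfolding resolvable_def using T by (intro ball_cong refl arg_cong[of _ _ Ex1] ext) (auto simp: fun_eq_iff)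
  finally show ?thesis unfolding op_spectrum_def T_def by simp
qed

text \<open>The right-hand side after eliminating the values at the words i v and i e_i(v), the
  neighbours of 0 v. The factor z - 4 clears the denominator of the elimination.\<close>

definition red :: "complex \<Rightarrow> ((nat \<Rightarrow> nat) \<Rightarrow> complex) \<Rightarrow> (nat \<Rightarrow> nat) \<Rightarrow> complex" where
  "red z g v = (z - 4) * g (0 #\<^sub>w v) + (\<Sum>i\<in>{1,2,3}. g (i #\<^sub>w v) + g (i #\<^sub>w ei i v))"

lemma adj_wcons_0: "adj f (0 #\<^sub>w v) = (\<Sum>i\<in>{1,2,3}. f (i #\<^sub>w ei i v) + f (i #\<^sub>w v))"
  by (simp add: adj_def ei_wcons eb_wcons)

lemma adj_wcons_pos:
  "i \<in> {1,2,3} \<Longrightarrow> adj f (i #\<^sub>w v) = f (0 #\<^sub>w v) + f (0 #\<^sub>w eb i v) + 4 * f (i #\<^sub>w v)"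
  by (auto simp: adj_def ei_wcons eb_wcons)

text \<open>The Schur complement of the block of words starting with a nonzero letter.\<close>

lemma red_equation:
  assumes "\<And>u. adj f u - z * f u = g u"
  shows "adj (\<lambda>v. f (0 #\<^sub>w v)) v - quad z * f (0 #\<^sub>w v) = red z g v"
proof -
  have "red z g v = (z - 4) * (adj f (0 #\<^sub>w v) - z * f (0 #\<^sub>w v)) +
      (\<Sum>i\<in>{1,2,3}. (adj f (i #\<^sub>w v) - z * f (i #\<^sub>w v)) + (adj f (i #\<^sub>w ei i v) - z * f (i #\<^sub>w ei i v)))"
    by (simp add: red_def assms)
  also have "\<dots> = adj (\<lambda>v. f (0 #\<^sub>w v)) v - quad z * f (0 #\<^sub>w v)"
    by (simp add: adj_wcons_0 adj_wcons_pos eb_ei adj_def[of "\<lambda>v. f (0 #\<^sub>w v)"] quad_def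
        power2_eq_square algebra_simps)
  finally show ?thesis ..
qed

lemma red_l2:
  assumes V: "invariant V" and g: "g \<in> l2 V"
  shows "red z g \<in> l2 (tail V)"
  unfolding red_def
proof (intro l2_add l2_cmult l2_sum)
  show "(\<lambda>v. g (0 #\<^sub>w v)) \<in> l2 (tail V)" using l2_wcons[OF V g] by simp
  fix i assume i: "i \<in> {1,2,3::nat}"
  then have *: "(\<lambda>v. g (i #\<^sub>w v)) \<in> l2 (tail V)" using l2_wcons[OF V g] by auto
  then show "(\<lambda>v. g (i #\<^sub>w v)) \<in> l2 (tail V)" .
  show "(\<lambda>v. g (i #\<^sub>w ei i v)) \<in> l2 (tail V)"
    using l2_ei[OF invariant_tail[OF V] i *] by simp
qed simp

text \<open>Back substitution: the equation at \<open>i #\<^sub>w v\<close> has the scalar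
  coefficient 4 - z and is solved for the value there.\<close>

definition lift :: "complex \<Rightarrow> ((nat \<Rightarrow> nat) \<Rightarrow> complex) \<Rightarrow> ((nat \<Rightarrow> nat) \<Rightarrow> complex) \<Rightarrow> (nat \<Rightarrow> nat) \<Rightarrow> complex" where
  "lift z g h = glue (\<lambda>x v. if x = 0 then h v else (1 / (4 - z)) * (g (x #\<^sub>w v) - (h v + h (eb x v))))"

lemma lift_wcons:
  "lift z g h (0 #\<^sub>w v) = h v"
  "i \<in> {1,2,3} \<Longrightarrow> lift z g h (i #\<^sub>w v) = (1 / (4 - z)) * (g (i #\<^sub>w v) - (h v + h (eb i v)))"
  by (auto simp: lift_def glue_wcons)

lemma lift_l2:
  assumes V: "invariant V" and g: "g \<in> l2 V" and h: "h \<in> l2 (tail V)"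
  shows "lift z g h \<in> l2 V"
  unfolding lift_def
proof (rule l2_glue[OF V])
  fix x :: nat assume x: "x < 4"
  show "(\<lambda>v. if x = 0 then h v else (1 / (4 - z)) * (g (x #\<^sub>w v) - (h v + h (eb x v)))) \<in> l2 (tail V)"
  proof (cases "x = 0")
    case False
    then have "(\<lambda>v. (1 / (4 - z)) * (g (x #\<^sub>w v) - (h v + h (eb x v)))) \<in> l2 (tail V)"
      using x by (intro l2_cmult l2_diff l2_add l2_wcons[OF V g] h l2_eb invariant_tail V) auto
    then show ?thesis using False by simp
  qed (use h in simp)
qed

lemma lift_equation:
  assumes V: "invariant V" and z: "z \<noteq> 4" and g: "g \<in> l2 V" and h: "h \<in> l2 (tail V)"
    and eq: "\<And>v. adj h v - quad z * h v = red z g v"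
  shows "adj (lift z g h) u - z * lift z g h u = g u"
proof (cases "u \<in> V")
  case False
  note l = l2_outside[OF lift_l2[OF V g h, of z]]
  show ?thesis using adj_outside[OF V l False] l[OF False] l2_outside[OF g False] by simp
next
  case True
  then obtain x v where u: "u = x #\<^sub>w v" "x < 4" by (rule invariant_cases[OF V])
  have nz: "4 - z \<noteq> 0" using z by simp
  show ?thesis
  proof (cases "x = 0")
    case False
    then have x: "x \<in> {1,2,3}" using u by auto
    have "adj (lift z g h) u - z * lift z g h u
        = h v + h (eb x v) + (4 - z) * ((1 / (4 - z)) * (g (x #\<^sub>w v) - (h v + h (eb x v))))"
      unfolding u adj_wcons_pos[OF x] lift_wcons lift_wcons(2)[OF x] by (simp only: algebra_simps)
    also have "\<dots> = g u" using nz u by simp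
    finally show ?thesis .
  next
    case True
    define f where "f = lift z g h"
    have f: "(4 - z) * f (i #\<^sub>w v) = g (i #\<^sub>w v) - (h v + h (eb i v))" if "i \<in> {1,2,3}" for i v
      using nz lift_wcons(2)[OF that] by (simp add: f_def)
    have "(4 - z) * (adj f u - z * f u) =
       (\<Sum>i\<in>{1,2,3}. (4 - z) * f (i #\<^sub>w ei i v) + (4 - z) * f (i #\<^sub>w v)) - (4 - z) * z * h v"
      unfolding u True adj_wcons_0 unfolding f_def lift_wcons(1)
      by (simp only: right_diff_distrib sum_distrib_left distrib_left mult.assoc)
    also have "\<dots> = (\<Sum>i\<in>{1,2,3}. (g (i #\<^sub>w ei i v) - (h (ei i v) + h v)) + (g (i #\<^sub>w v) - (h v + h (eb i v))))
        - (4 - z) * z * h v"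
    proof (intro arg_cong2[where f = minus] sum.cong refl)
      fix i assume i: "i \<in> {1,2,3::nat}"
      then have "eb i (ei i v) = v" by (intro eb_ei) auto
      then show "(4 - z) * f (i #\<^sub>w ei i v) + (4 - z) * f (i #\<^sub>w v) =
          (g (i #\<^sub>w ei i v) - (h (ei i v) + h v)) + (g (i #\<^sub>w v) - (h v + h (eb i v)))"
        using f[OF i, of v] f[OF i, of "ei i v"] by simp
    qed
    also have "\<dots> = (\<Sum>i\<in>{1,2,3}. g (i #\<^sub>w v) + g (i #\<^sub>w ei i v)) - (adj h v - quad z * h v)"
      by (simp add: adj_def quad_def power2_eq_square algebra_simps)
    also have "\<dots> = (4 - z) * g u"
      unfolding eq red_def u True by (simp only: algebra_simps)
    finally show ?thesis using nz unfolding f_def by (simp only: mult_cancel_left) simp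
  qed
qed

lemma resolvable_tail_iff:
  assumes V: "invariant V" and z: "z \<noteq> 4"
  shows "resolvable V z \<longleftrightarrow> resolvable (tail V) (quad z)"
proof
  assume res: "resolvable V z"
  show "resolvable (tail V) (quad z)"
    unfolding resolvable_def
  proof
    fix g' assume g': "g' \<in> l2 (tail V)"
    \<comment> \<open>Chosen so that \<open>red z g = g'\<close>: only the first term of
      \<open>red\<close> sees it, and that term multiplies by z - 4.\<close>
    define g where "g = glue (\<lambda>x v. if x = 0 then (1 / (z - 4)) * g' v else 0)"
    have g: "g \<in> l2 V"
      unfolding g_def
    proof (rule l2_glue[OF V])
      fix x :: nat
      show "(\<lambda>v. if x = 0 then (1 / (z - 4)) * g' v else 0) \<in> l2 (tail V)"
        by (cases "x = 0") (auto intro: l2_zero l2_cmult[OF g'] simp del: times_divide_eq_left mult_1)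
    qed
    have red: "red z g v = g' v" for v
      using z by (simp add: red_def g_def glue_wcons)
    from res g obtain f where f: "f \<in> l2 V" "\<And>v. adj f v - z * f v = g v"
      and uniq: "\<And>f'. f' \<in> l2 V \<Longrightarrow> (\<forall>v. adj f' v - z * f' v = g v) \<Longrightarrow> f' = f"
      unfolding resolvable_def by metis
    show "\<exists>!h. h \<in> l2 (tail V) \<and> (\<forall>v. adj h v - quad z * h v = g' v)"
    proof (intro ex1I[of _ "\<lambda>v. f (0 #\<^sub>w v)"] conjI allI)
      show "(\<lambda>v. f (0 #\<^sub>w v)) \<in> l2 (tail V)" using l2_wcons[OF V f(1)] by simp
      show "adj (\<lambda>v. f (0 #\<^sub>w v)) v - quad z * f (0 #\<^sub>w v) = g' v" for v
        using red_equation[OF f(2)] red by simp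
      fix h assume h: "h \<in> l2 (tail V) \<and> (\<forall>v. adj h v - quad z * h v = g' v)"
      then have "lift z g h = f"
        by (intro uniq lift_l2 allI lift_equation V z g) (auto simp: red V g)
      then show "h = (\<lambda>v. f (0 #\<^sub>w v))" using lift_wcons(1)[of z g h] by auto
    qed
  qed
next
  assume res: "resolvable (tail V) (quad z)"
  show "resolvable V z"
    unfolding resolvable_def
  proof
    fix g assume g: "g \<in> l2 V"
    from res red_l2[OF V g, of z] obtain h
      where h: "h \<in> l2 (tail V)" "\<And>v. adj h v - quad z * h v = red z g v"
      and uniq: "\<And>h'. h' \<in> l2 (tail V) \<Longrightarrow> (\<forall>v. adj h' v - quad z * h' v = red z g v) \<Longrightarrow> h' = h"
      unfolding resolvable_def by metis
    show "\<exists>!f. f \<in> l2 V \<and> (\<forall>v. adj f v - z * f v = g v)"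
    proof (intro ex1I[of _ "lift z g h"] conjI allI)
      show "lift z g h \<in> l2 V" by (rule lift_l2[OF V g h(1)])
      show "adj (lift z g h) v - z * lift z g h v = g v" for v
        by (rule lift_equation[OF V z g h])
      fix f assume f: "f \<in> l2 V \<and> (\<forall>v. adj f v - z * f v = g v)"
      \<comment> \<open>The reduced equation forces the values at words starting with 0; the
        equations at nonzero letters, divided by 4 - z, then force the others.\<close>
      have f0: "(\<lambda>v. f (0 #\<^sub>w v)) = h"
        using f l2_wcons[OF V, of f 0] red_equation[of f z g] by (intro uniq) auto
      show "f = lift z g h"
      proof
        fix u
        show "f u = lift z g h u"
        proof (cases "u \<in> V")
          case True
          then obtain x v where u: "u = x #\<^sub>w v" "x < 4" by (rule invariant_cases[OF V])
          show ?thesis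
          proof (cases "x = 0")
            case False
            then have x: "x \<in> {1,2,3}" using u by auto
            have "h v + h (eb x v) + 4 * f u - z * f u = g u"
              using spec[OF conjunct2[OF f], of "x #\<^sub>w v"] adj_wcons_pos[OF x, of f v] u
                fun_cong[OF f0, of v] fun_cong[OF f0, of "eb x v"]
              by simp
            then have "(4 - z) * f u = g u - (h v + h (eb x v))" by (simp add: algebra_simps)
            also have "\<dots> = (4 - z) * lift z g h u"
              using z u lift_wcons(2)[OF x, of z g h v] by simp
            finally show ?thesis using z by simp
          qed (use u lift_wcons(1) fun_cong[OF f0] in simp)
        qed (use f l2_outside[of f V u] l2_outside[OF lift_l2[OF V g h(1)], of u z] in simp)
      qed
    qed
  qed
qed

lemma l2_delta: "u \<in> V \<Longrightarrow> (\<lambda>v. if v = u then 1 else 0) \<in> l2 V"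
proof -
  assume u: "u \<in> V"
  have "l2_le V (\<lambda>v. if v = u then 1 else 0) 1"
    unfolding l2_le_def L2_set_def
  proof (intro allI impI)
    fix F assume "finite F \<and> F \<subseteq> V"
    then have "(\<Sum>v\<in>F. (cmod (if v = u then 1 else 0))\<^sup>2) = (\<Sum>v\<in>F. if v = u then 1 else 0)"
      by (intro sum.cong) auto
    also have "\<dots> \<le> 1" by (subst sum.delta) (use \<open>finite F \<and> F \<subseteq> V\<close> in auto)
    finally show "sqrt (\<Sum>v\<in>F. (cmod (if v = u then 1 else 0))\<^sup>2) \<le> 1" by simp
  qed
  then show ?thesis using u by (auto simp: mem_l2_iff)
qed

text \<open>At z = 4 the equation at i v loses its diagonal term and reads f(0 v) + f(0 e_i^{-1}(v))
  = g(i v). If v starts with 3, it is fixed by e_1 and e_2, so the left sides at 1 v and 2 v agree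
  and a point mass at 2 v is not attained.\<close>

lemma not_resolvable_4:
  assumes V: "invariant V"
  shows "\<not> resolvable V 4"
proof
  assume res: "resolvable V 4"
  note V' = invariant_tail[OF V]
  obtain u where u: "u \<in> tail (tail V)" using invariant_tail[OF V'] by (auto simp: invariant_def)
  define v where "v = 3 #\<^sub>w u"
  have v: "v \<in> tail V" using wcons_mem_iff_tail[OF V', of 3 u] u by (simp add: v_def)
  have fixed: "eb 1 v = v" "eb 2 v = v" by (simp_all add: v_def eb_wcons)
  have "2 #\<^sub>w v \<in> V" using wcons_mem_iff_tail[OF V, of 2 v] v by simp
  from l2_delta[OF this] res obtain f where
    f: "\<And>x. adj f x - 4 * f x = (if x = 2 #\<^sub>w v then 1 else 0)"
    unfolding resolvable_def by blast
  from f[of "1 #\<^sub>w v"] f[of "2 #\<^sub>w v"] show False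
    by (simp add: adj_wcons_pos fixed[unfolded One_nat_def])
qed

section \<open>Parameters beyond the norm bound\<close>

lemma adj_sums:
  assumes "\<And>v. (\<lambda>k. h k v) sums f v"
  shows "(\<lambda>k. adj (h k) v) sums adj f v"
  unfolding adj_def by (intro sums_sum sums_add assms)

lemma adj_cmult: "adj (\<lambda>v. c * f v) v = c * adj f v"
  by (simp add: adj_def algebra_simps)

lemma resolvable_large:
  assumes V: "invariant V" and z: "cmod z > 6"
  shows "resolvable V z"
  unfolding resolvable_def
proof
  fix g assume g: "g \<in> l2 V"
  obtain B where B: "l2_le V g B" using g by (auto simp: mem_l2_iff)
  note B0 = l2_le_nonneg[OF B]
  have z0: "z \<noteq> 0" using z by auto
  have z1: "6 / cmod z < 1" using z by (subst divide_less_eq_1_pos) auto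
  \<comment> \<open>Terms of the Neumann series of the inverse of A - z; \<open>b\<close> is the
    geometric bound for their norms, with ratio 6/|z|.\<close>
  define h where "h k v = - (1 / z ^ Suc k) * (adj ^^ k) g v" for k v
  define b where "b k = B / 6 * (6 / cmod z) ^ Suc k" for k
  have iter: "l2_le V ((adj ^^ k) g) (6 ^ k * B) \<and> (adj ^^ k) g \<in> l2 V" for k
  proof (induction k)
    case (Suc k)
    then show ?case using l2_le_adj[OF V, of "(adj ^^ k) g" "6 ^ k * B"] l2_adj[OF V]
      by (simp add: mult.assoc)
  qed (use B g in simp)
  have hb: "l2_le V (h k) (b k)" for k
  proof -
    have "l2_le V (h k) (cmod (- (1 / z ^ Suc k)) * (6 ^ k * B))"
      unfolding h_def by (rule l2_le_cmult) (use iter in auto)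
    also have "cmod (- (1 / z ^ Suc k)) * (6 ^ k * B) = b k"
      by (simp add: b_def norm_divide norm_power norm_mult power_divide)
    finally show ?thesis .
  qed
  have h0: "h k v = 0" if "v \<notin> V" for k v
    using l2_outside[OF conjunct2[OF iter[of k]] that] by (simp add: h_def)
  have sb: "summable b"
    unfolding b_def by (intro summable_mult summable_ignore_initial_segment[of _ 1, simplified] summable_geometric)
      (use z1 in simp)
  have b0: "b k \<ge> 0" for k using B0 by (simp add: b_def)
  have hv: "cmod (h k v) \<le> b k" for k v
    using l2_le_pointwise[OF hb] h0 b0 by (cases "v \<in> V") auto
  define f where "f v = (\<Sum>k. h k v)" for v
  have hs: "(\<lambda>k. h k v) sums f v" for v
    unfolding f_def by (intro summable_sums summable_comparison_test'[OF sb, of 0] hv)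
  have f_out: "f v = 0" if "v \<notin> V" for v using h0[OF that] by (simp add: f_def)
  have "l2_le V f (suminf b)"
    unfolding l2_le_def
  proof (intro allI impI)
    fix F assume F: "finite F \<and> F \<subseteq> V"
    have part: "l2_le V (\<lambda>v. \<Sum>k<n. h k v) (\<Sum>k<n. b k)" for n
      by (induction n) (auto intro: l2_le_zero l2_le_add hb)
    have lim: "(\<lambda>n. L2_set (\<lambda>v. cmod (\<Sum>k<n. h k v)) F) \<longlonglongrightarrow> L2_set (\<lambda>v. cmod (f v)) F"
      unfolding L2_set_def using hs unfolding sums_def by (intro tendsto_intros) auto
    have "L2_set (\<lambda>v. cmod (\<Sum>k<n. h k v)) F \<le> suminf b" for n
    proof -
      have "L2_set (\<lambda>v. cmod (\<Sum>k<n. h k v)) F \<le> (\<Sum>k<n. b k)"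
        using l2_leD[OF part] F by auto
      also have "\<dots> \<le> suminf b" by (rule sum_le_suminf[OF sb]) (use b0 in auto)
      finally show ?thesis .
    qed
    then show "L2_set (\<lambda>v. cmod (f v)) F \<le> suminf b"
      using lim by (intro LIMSEQ_le_const2[OF lim]) auto
  qed
  then have fl2: "f \<in> l2 V" using f_out by (auto simp: mem_l2_iff)
  have eq: "adj f v - z * f v = g v" for v
  proof -
    have "adj (h k) v = z * h (Suc k) v" for k
      using z0 unfolding h_def adj_cmult by simp
    then have 1: "(\<lambda>k. z * h (Suc k) v) sums adj f v" using adj_sums[of h f v] hs by simp
    have "(\<lambda>k. z * h k v) sums (z * f v)" by (rule sums_mult[OF hs])
    moreover have "(\<lambda>k. z * h k v) sums (adj f v + z * h 0 v)" using 1 by (rule sums_Suc)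
    ultimately have "z * f v = adj f v + z * h 0 v" by (rule sums_unique2)
    moreover have "z * h 0 v = - g v" using z0 by (simp add: h_def)
    ultimately show ?thesis by simp
  qed
  show "\<exists>!f. f \<in> l2 V \<and> (\<forall>v. adj f v - z * f v = g v)"
  proof (intro ex1I[of _ f] conjI allI fl2 eq)
    fix f' assume f': "f' \<in> l2 V \<and> (\<forall>v. adj f' v - z * f' v = g v)"
    define d where "d v = f' v - f v" for v
    have d: "d \<in> l2 V" unfolding d_def using f' fl2 by (auto intro: l2_diff)
    then obtain D where D: "l2_le V d D" by (auto simp: mem_l2_iff)
    \<comment> \<open>A homogeneous solution reproduces itself, so its norm bound may be multiplied
      by 6/|z| arbitrarily often.\<close>
    have ad: "d = (\<lambda>v. (1 / z) * adj d v)"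
    proof
      fix v
      have "adj d v = adj f' v - adj f v" by (simp add: adj_def d_def algebra_simps)
      also have "\<dots> = (g v + z * f' v) - (g v + z * f v)"
        using f' eq[of v] by (simp add: diff_eq_eq)
      also have "\<dots> = z * d v" by (simp add: d_def algebra_simps)
      finally show "d v = (1 / z) * adj d v" using z0 by simp
    qed
    have Dn: "l2_le V d ((6 / cmod z) ^ n * D)" for n
    proof (induction n)
      case (Suc n)
      have "l2_le V (\<lambda>v. (1 / z) * adj d v) (cmod (1 / z) * (6 * ((6 / cmod z) ^ n * D)))"
        by (intro l2_le_cmult l2_le_adj V Suc)
      then have "l2_le V d (cmod (1 / z) * (6 * ((6 / cmod z) ^ n * D)))"
        by (simp only: ad[symmetric])
      then show ?case by (simp add: norm_divide mult.assoc)
    qed (use D in simp)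
    have "d v = 0" for v
    proof (cases "v \<in> V")
      case True
      have "(\<lambda>n. (6 / cmod z) ^ n * D) \<longlonglongrightarrow> 0 * D"
        by (intro tendsto_intros LIMSEQ_power_zero) (use z1 in simp)
      then have "cmod (d v) \<le> 0 * D"
        using l2_le_pointwise[OF Dn True] by (intro LIMSEQ_le_const) auto
      then show ?thesis by simp
    qed (rule l2_outside[OF d])
    then show "f' = f" by (auto simp: d_def fun_eq_iff)
  qed
qed

section \<open>The spectrum\<close>

lemma red_add: "red z (\<lambda>u. a u + b u) v = red z a v + red z b v"
  by (simp add: red_def algebra_simps)

fun redn :: "nat \<Rightarrow> complex \<Rightarrow> ((nat \<Rightarrow> nat) \<Rightarrow> complex) \<Rightarrow> (nat \<Rightarrow> nat) \<Rightarrow> complex" where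
  "redn 0 z g = g"
| "redn (Suc n) z g = redn n (quad z) (red z g)"

lemma redn_add: "redn n z (\<lambda>u. a u + b u) v = redn n z a v + redn n z b v"
proof (induction n arbitrary: z a b)
  case (Suc n)
  have "red z (\<lambda>u. a u + b u) = (\<lambda>v. red z a v + red z b v)" by (simp add: fun_eq_iff red_add)
  then show ?case by (simp add: Suc)
qed simp

fun zeros :: "nat \<Rightarrow> (nat \<Rightarrow> nat) \<Rightarrow> nat \<Rightarrow> nat" where
  "zeros 0 v = v"
| "zeros (Suc n) v = 0 #\<^sub>w zeros n v"

lemma zeros_add: "zeros (m + n) v = zeros m (zeros n v)"
  by (induction m) auto

lemma zeros_eq_iff [simp]: "zeros n u = zeros n v \<longleftrightarrow> u = v"
  by (induction n) auto

lemma redn_equation: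
  assumes "\<And>u. adj f u - z * f u = g u"
  shows "adj (\<lambda>v. f (zeros n v)) v - (quad ^^ n) z * f (zeros n v) = redn n z g v"
  using assms
proof (induction n arbitrary: f z g)
  case (Suc n)
  show ?case
    using Suc.IH[of "\<lambda>v. f (0 #\<^sub>w v)" "quad z" "red z g"] red_equation[OF Suc.prems]
    by (simp add: funpow_swap1)
qed simp

text \<open>A function supported on words with n leading zeros never feeds the sum in
  \<open>red\<close>, so step k only multiplies by x_k - 4, with x_k the k-th iterate of z.\<close>

lemma redn_zeros:
  assumes "\<And>u. g u \<noteq> 0 \<Longrightarrow> \<exists>v. u = zeros n v"
  shows "redn n z g v = (\<Prod>k<n. (quad ^^ k) z - 4) * g (zeros n v)"
  using assms
proof (induction n arbitrary: z g)
  case (Suc n)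
  have pos: "g (i #\<^sub>w u) = 0" if "i \<in> {1,2,3}" for i u
    by (rule ccontr) (use Suc.prems[of "i #\<^sub>w u"] that in auto)
  have red: "red z g u = (z - 4) * g (0 #\<^sub>w u)" for u
    using pos by (simp add: red_def)
  have supp: "\<exists>v. u = zeros n v" if "red z g u \<noteq> 0" for u
    using Suc.prems[of "0 #\<^sub>w u"] that by (auto simp: red)
  have "redn (Suc n) z g v = (\<Prod>k<n. (quad ^^ k) (quad z) - 4) * red z g (zeros n v)"
    using Suc.IH[OF supp] by simp
  also have "\<dots> = (z - 4) * (\<Prod>k<n. (quad ^^ Suc k) z - 4) * g (zeros (Suc n) v)"
    by (simp add: red funpow_swap1)
  also have "(z - 4) * (\<Prod>k<n. (quad ^^ Suc k) z - 4) = (\<Prod>k<Suc n. (quad ^^ k) z - 4)"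
    unfolding prod.lessThan_Suc_shift by simp
  finally show ?case .
qed simp

lemma invariant_funpow_tail: "invariant V \<Longrightarrow> invariant ((tail ^^ n) V)"
  by (induction n) (auto intro: invariant_tail)

lemma zeros_mem: "zeros n v \<in> V \<longleftrightarrow> v \<in> (tail ^^ n) V"
proof (induction n arbitrary: V)
  case (Suc n)
  have "zeros (Suc n) v \<in> V \<longleftrightarrow> zeros n v \<in> tail V" by (simp add: tail_def)
  also have "\<dots> \<longleftrightarrow> v \<in> (tail ^^ Suc n) V" by (simp only: Suc funpow_Suc_apply)
  finally show ?case .
qed simp

text \<open>Otherwise solving $(A - x) f = g$ would bound all reductions of $g$ uniformly, since the
  $n$-th reduction is $(A - x_n)$ applied to the restriction of $f$ to $0^n X^\infty$.
  But the reduction of a point mass at $0^n 1 v$ is amplified by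
  $\prod_{k<n} |x_k - 4|$; the signs in $g$ prevent cancellation.\<close>

lemma not_resolvable_julia:
  assumes V: "invariant V" and x: "x \<in> julia"
  shows "\<not> resolvable V (of_real x)"
proof
  define z where "z = complex_of_real x"
  assume "resolvable V (of_real x)"
  then have res: "resolvable V z" by (simp add: z_def)
  have "\<exists>v. 1 #\<^sub>w v \<in> (tail ^^ n) V" for n
  proof -
    note Vn = invariant_funpow_tail[OF V, of n]
    obtain v where "v \<in> tail ((tail ^^ n) V)"
      using invariant_tail[OF Vn] by (auto simp: invariant_def)
    then show ?thesis using wcons_mem_iff_tail[OF Vn, of 1 v] by auto
  qed
  then obtain p where p: "\<And>n. 1 #\<^sub>w p n \<in> (tail ^^ n) V" by metis
  \<comment> \<open>The letter 1 marks the end of the zeros, so these points are distinct for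
    distinct n, whatever \<open>p n\<close> is.\<close>
  define U where "U n = zeros n (1 #\<^sub>w p n)" for n
  have U_V: "U n \<in> V" for n using p by (simp add: U_def zeros_mem)
  have U_neq: "U m \<noteq> U n" if "m < n" for m n
  proof -
    have "U n = zeros m (zeros (Suc (n - m - 1)) (1 #\<^sub>w p n))"
      unfolding U_def zeros_add[symmetric] using that by simp
    then show ?thesis by (simp add: U_def)
  qed
  then have injU: "inj U" by (rule linorder_injI)
  define gen where "gen c u = (if u \<in> range U then c (inv_into UNIV U u) else 0)"
    for c :: "nat \<Rightarrow> complex" and u
  have gen_U: "gen c (U n) = c n" for c n by (simp add: gen_def injU)
  define P where "P n = (\<Prod>k<n. (quad ^^ k) z - 4)" for n
  \<comment> \<open>Below 1 for square summability, yet large enough that 6/5 * 10/11 = 12/11 > 1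
    keeps the amplified coefficients unbounded.\<close>
  define r :: real where "r = 10 / 11"
  define coef where "coef s n = complex_of_real (s n * r ^ n)" for s :: "nat \<Rightarrow> real" and n
  \<comment> \<open>Masses at \<open>U m\<close> with m >= n lie on words with n leading zeros, and
    of these only \<open>U n\<close> is seen at the evaluation point.\<close>
  have gen_high: "redn n z (gen (\<lambda>m. if m < n then 0 else c m)) (1 #\<^sub>w p n) = P n * c n" for n c
  proof -
    have "\<exists>v. u = zeros n v" if u: "gen (\<lambda>m. if m < n then 0 else c m) u \<noteq> 0" for u
    proof -
      obtain m where m: "u = U m" using u by (auto simp: gen_def split: if_splits)
      then have "n \<le> m" using u by (auto simp: gen_U split: if_splits)
      then have "u = zeros n (zeros (m - n) (1 #\<^sub>w p m))"
        unfolding m U_def zeros_add[symmetric] by simp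
      then show ?thesis by blast
    qed
    then have "redn n z (gen (\<lambda>m. if m < n then 0 else c m)) (1 #\<^sub>w p n)
        = P n * gen (\<lambda>m. if m < n then 0 else c m) (U n)"
      unfolding P_def U_def by (rule redn_zeros)
    then show ?thesis by (simp add: gen_U)
  qed
  have split: "redn n z (gen c) (1 #\<^sub>w p n)
      = redn n z (gen (\<lambda>m. if m < n then c m else 0)) (1 #\<^sub>w p n) + P n * c n" for n c
  proof -
    have "gen c = (\<lambda>u. gen (\<lambda>m. if m < n then c m else 0) u + gen (\<lambda>m. if m < n then 0 else c m) u)"
      by (auto simp: gen_def)
    then show ?thesis by (subst \<open>gen c = _\<close>) (simp only: redn_add gen_high)
  qed
  \<comment> \<open>Signs are chosen recursively: at stage n the contribution a of the earlier
    masses is fixed, and one of |a + b|, |a - b| is at least |b|.\<close>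
  have "\<exists>s :: nat \<Rightarrow> real. \<forall>n. s n \<in> {1, -1} \<and>
      cmod (redn n z (gen (\<lambda>m. if m < n then coef s m else 0)) (1 #\<^sub>w p n)
        + P n * of_real (s n * r ^ n)) \<ge> cmod (P n) * r ^ n"
  proof (rule dependent_wf_choice[where R = "{(m, n). m < n}"])
    show "wf {(m, n :: nat). m < n}" by (rule wf)
  next
    fix f g :: "nat \<Rightarrow> real" and n and t :: real
    assume "\<And>m. (m, n) \<in> {(m, n). m < n} \<Longrightarrow> f m = g m"
    then have "(\<lambda>m. if m < n then coef f m else 0) = (\<lambda>m. if m < n then coef g m else 0)"
      by (auto simp: coef_def fun_eq_iff)
    then show "(t \<in> {1, -1} \<and>
      cmod (redn n z (gen (\<lambda>m. if m < n then coef f m else 0)) (1 #\<^sub>w p n)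
        + P n * of_real (t * r ^ n)) \<ge> cmod (P n) * r ^ n) \<longleftrightarrow> (t \<in> {1, -1} \<and>
      cmod (redn n z (gen (\<lambda>m. if m < n then coef g m else 0)) (1 #\<^sub>w p n)
        + P n * of_real (t * r ^ n)) \<ge> cmod (P n) * r ^ n)" by simp
  next
    fix n and f :: "nat \<Rightarrow> real"
    define a where "a = redn n z (gen (\<lambda>m. if m < n then coef f m else 0)) (1 #\<^sub>w p n)"
    define b where "b = P n * of_real (r ^ n)"
    have cb: "cmod b = cmod (P n) * r ^ n"
      by (simp add: b_def norm_mult norm_power r_def)
    have "2 * cmod b = cmod ((a + b) - (a - b))" by (simp add: norm_mult flip: mult_2)
    also have "\<dots> \<le> cmod (a + b) + cmod (a - b)" by (rule norm_triangle_ineq4)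
    finally have "cmod (a + b) \<ge> cmod b \<or> cmod (a - b) \<ge> cmod b" by linarith
    then show "\<exists>t. t \<in> {1, -1} \<and>
      cmod (redn n z (gen (\<lambda>m. if m < n then coef f m else 0)) (1 #\<^sub>w p n)
        + P n * of_real (t * r ^ n)) \<ge> cmod (P n) * r ^ n"
      unfolding a_def[symmetric] cb[symmetric]
      by (elim disjE) (auto intro: exI[of _ 1] exI[of _ "-1"] simp: b_def)
  qed
  then obtain s :: "nat \<Rightarrow> real" where sn: "\<forall>n. s n \<in> {1, -1} \<and>
      cmod (redn n z (gen (\<lambda>m. if m < n then coef s m else 0)) (1 #\<^sub>w p n)
        + P n * of_real (s n * r ^ n)) \<ge> cmod (P n) * r ^ n" by (rule exE)
  note s = conjunct1[OF spec[OF sn]] and big = conjunct2[OF spec[OF sn]]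
  define g where "g = gen (coef s)"
  have large: "cmod (redn n z g (1 #\<^sub>w p n)) \<ge> cmod (P n) * r ^ n" for n
    using big[of n] split[of n "coef s"] by (simp add: g_def coef_def)
  have "l2_le V g (sqrt (\<Sum>n. (r\<^sup>2) ^ n))"
    unfolding l2_le_def L2_set_def
  proof (intro allI impI real_sqrt_le_mono)
    fix F assume F: "finite F \<and> F \<subseteq> V"
    define N where "N = {n. U n \<in> F}"
    have N: "finite N" "F \<inter> range U = U ` N"
      using F finite_vimageI[of F U] injU by (auto simp: N_def vimage_def)
    have sm: "summable (\<lambda>n. (r\<^sup>2) ^ n)"
      by (rule summable_geometric) (simp add: r_def power2_eq_square)
    have "(\<Sum>u\<in>F. (cmod (g u))\<^sup>2) = (\<Sum>u\<in>U ` N. (cmod (g u))\<^sup>2)"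
      unfolding N(2)[symmetric] using F
      by (intro sum.mono_neutral_right) (auto simp: g_def gen_def)
    also have "\<dots> = (\<Sum>n\<in>N. (cmod (coef s n))\<^sup>2)"
      using injU by (subst sum.reindex) (auto simp: g_def gen_U intro: inj_on_subset)
    also have "\<dots> = (\<Sum>n\<in>N. (r\<^sup>2) ^ n)"
    proof (intro sum.cong refl)
      fix n
      have "(cmod (coef s n))\<^sup>2 = (s n)\<^sup>2 * (r ^ n)\<^sup>2"
        unfolding coef_def norm_of_real by (simp add: power_mult_distrib)
      also have "(s n)\<^sup>2 = 1" using s[of n] by auto
      finally show "(cmod (coef s n))\<^sup>2 = (r\<^sup>2) ^ n" by (simp add: power_mult[symmetric] mult.commute)
    qed
    also have "\<dots> \<le> (\<Sum>n. (r\<^sup>2) ^ n)"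
      by (rule sum_le_suminf[OF sm N(1)]) simp
    finally show "(\<Sum>u\<in>F. (cmod (g u))\<^sup>2) \<le> (\<Sum>n. (r\<^sup>2) ^ n)" .
  qed
  moreover have "g u = 0" if "u \<notin> V" for u using that U_V by (auto simp: g_def gen_def)
  ultimately have "g \<in> l2 V" by (auto simp: mem_l2_iff)
  from ex1_implies_ex[OF bspec[OF res[unfolded resolvable_def] this]]
  obtain f where f: "f \<in> l2 V" "\<And>v. adj f v - z * f v = g v" by auto
  obtain B where B: "l2_le V f B" using f(1) by (auto simp: mem_l2_iff)
  have fB: "cmod (f u) \<le> B" for u
    using l2_le_pointwise[OF B] l2_le_nonneg[OF B] l2_outside[OF f(1)] by (cases "u \<in> V") auto
  \<comment> \<open>6 B from the six neighbours and 6 B from the parameter, whose iterates stay in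
    [-2,6].\<close>
  have small: "cmod (redn n z g v) \<le> 12 * B" for n v
  proof -
    have adjB: "cmod (adj (\<lambda>v. f (zeros n v)) v) \<le> 6 * B"
    proof -
      have "cmod (adj (\<lambda>v. f (zeros n v)) v) \<le> (\<Sum>i\<in>{1,2,3::nat}. B + B)"
        unfolding adj_def by (intro sum_norm_le norm_triangle_le add_mono fB)
      then show ?thesis by simp
    qed
    have "(quad ^^ n) x \<in> {-2..6}" using x by (auto simp: julia_def)
    then have "cmod ((quad ^^ n) z) \<le> 6"
      unfolding z_def funpow_quad_of_real norm_of_real by auto
    then have "cmod ((quad ^^ n) z * f (zeros n v)) \<le> 6 * B"
      unfolding norm_mult by (intro mult_mono fB) auto
    then show ?thesis
      using adjB norm_triangle_ineq4[of "adj (\<lambda>v. f (zeros n v)) v" "(quad ^^ n) z * f (zeros n v)"]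
      unfolding redn_equation[OF f(2)] by simp
  qed
  have Pn: "cmod (P n) \<ge> 1/2 * (6/5) ^ n" for n
  proof -
    have "cmod (P n) = (\<Prod>k<n. \<bar>(quad ^^ k) x - 4\<bar>)"
      unfolding P_def z_def funpow_quad_of_real prod_norm[symmetric]
      using norm_of_real[of "(quad ^^ _) x - 4", where 'a = complex] by simp
    then show ?thesis using julia_prod_growth[OF x, of n] by simp
  qed
  obtain n where n: "24 * B < (12 / 11) ^ n" using real_arch_pow[of "12/11" "24 * B"] by auto
  have "12 * B < 1/2 * (12 / 11) ^ n" using n by simp
  also have "\<dots> = (1/2 * (6/5) ^ n) * r ^ n"
    by (simp add: r_def flip: power_mult_distrib)
  also have "\<dots> \<le> cmod (P n) * r ^ n" using Pn by (intro mult_right_mono) (auto simp: r_def)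
  also have "\<dots> \<le> 12 * B" using large[of n] small[of n] by (rule order_trans)
  finally show False by simp
qed

text \<open>The radicand 10 + a is positive, so both complex square roots are real; hence passing to
  complex parameters adds no preimages of 4.\<close>

lemma quad_complex_eq_real:
  fixes z :: complex
  assumes "quad z = of_real a" "a \<in> {-2..6}"
  shows "\<exists>b. z = of_real b \<and> quad b = a"
proof -
  have s: "(complex_of_real (sqrt (10 + a)))\<^sup>2 = 10 + of_real a"
    using assms(2) by (simp flip: of_real_power)
  have "(z - 2)\<^sup>2 = (of_real (sqrt (10 + a)))\<^sup>2"
    using assms(1) unfolding s by (simp add: quad_shift diff_eq_eq)
  then have "z = of_real (2 + sqrt (10 + a)) \<or> z = of_real (2 - sqrt (10 + a))"
    unfolding power2_eq_iff by (auto simp: algebra_simps)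
  then show ?thesis using quad_eq_iff[OF assms(2)] by blast
qed

lemma funpow_quad_complex_eq_4: "(quad ^^ n) (z :: complex) = 4 \<Longrightarrow> z \<in> of_real ` level n"
proof (induction n arbitrary: z)
  case 0
  then show ?case by (auto simp: level_0)
next
  case (Suc n)
  then have "(quad ^^ n) (quad z) = 4" by (simp add: funpow_swap1)
  then obtain a where a: "quad z = of_real a" "a \<in> level n" using Suc.IH by auto
  moreover have "a \<in> {-2..6}" using a level_inside by blast
  ultimately obtain b where "z = of_real b" "quad b = a" using quad_complex_eq_real by blast
  then show ?case using a by (auto simp: level_Suc)
qed

lemma not_resolvable_level:
  assumes "invariant V" "x \<in> level n"
  shows "\<not> resolvable V (of_real x)"
  using assms
proof (induction n arbitrary: V x)
  case 0
  then show ?case using not_resolvable_4 by (simp add: level_0)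
next
  case (Suc n)
  then have q: "quad x \<in> level n" by (simp add: level_Suc)
  show ?case
  proof (cases "x = 4")
    case True
    then show ?thesis using not_resolvable_4[OF Suc.prems(1)] by simp
  next
    case False
    then have "complex_of_real x \<noteq> 4"
      using of_real_eq_iff[of x 4, where 'a = complex] by simp
    from resolvable_tail_iff[OF Suc.prems(1) this] Suc.IH[OF invariant_tail[OF Suc.prems(1)] q]
    show ?thesis by (simp add: quad_of_real)
  qed
qed

lemma resolvable_escape:
  assumes "invariant V" "cmod ((quad ^^ n) z) > 6" "\<And>k. (quad ^^ k) z \<noteq> 4"
  shows "resolvable V z"
  using assms
proof (induction n arbitrary: V z)
  case 0
  then show ?case using resolvable_large by simp
next
  case (Suc n)
  have "z \<noteq> 4" using Suc.prems(3)[of 0] by simp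
  moreover have "resolvable (tail V) (quad z)"
  proof (rule Suc.IH)
    show "cmod ((quad ^^ n) (quad z)) > 6" using Suc.prems(2) by (simp only: funpow_Suc_apply)
    show "(quad ^^ k) (quad z) \<noteq> 4" for k
      using Suc.prems(3)[of "Suc k"] by (simp only: funpow_Suc_apply) simp
  qed (rule invariant_tail[OF Suc.prems(1)])
  ultimately show ?case using resolvable_tail_iff[OF Suc.prems(1)] by blast
qed

theorem spectrum_invariant:
  assumes V: "invariant V"
  shows "op_spectrum V (adj_op V) = of_real ` ((\<Union>n. level n) \<union> julia)"
proof (intro equalityI subsetI)
  fix z assume "z \<in> op_spectrum V (adj_op V)"
  then have nres: "\<not> resolvable V z" using op_spectrum_iff[OF V] by simp
  show "z \<in> of_real ` ((\<Union>n. level n) \<union> julia)"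
  proof (rule ccontr)
    assume z: "z \<notin> of_real ` ((\<Union>n. level n) \<union> julia)"
    then obtain n where n: "cmod ((quad ^^ n) z) > 6" using escape_or_julia[of z] by auto
    have "(quad ^^ k) z \<noteq> 4" for k using funpow_quad_complex_eq_4[of k z] z by auto
    with resolvable_escape[OF V n] nres show False by simp
  qed
next
  fix z :: complex assume "z \<in> of_real ` ((\<Union>n. level n) \<union> julia)"
  then show "z \<in> op_spectrum V (adj_op V)"
    using not_resolvable_level[OF V] not_resolvable_julia[OF V] op_spectrum_iff[OF V] by auto
qed

section \<open>Characteristic polynomials of the finite graphs\<close>

text \<open>Base 4 digits, most significant first: words with a common first letter occupy
  consecutive indices, as block matrices require.\<close>

fun word :: "nat \<Rightarrow> nat \<Rightarrow> nat list" where
  "word 0 k = []"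
| "word (Suc n) k = (k div 4 ^ n) # word n (k mod 4 ^ n)"

lemma Wn_Suc: "Wn (Suc n) = (\<lambda>(x, w). x # w) ` ({0..<4} \<times> Wn n)"
  unfolding Wn_def by (auto simp: length_Suc_conv image_iff)

lemma word_block: "j < 4 ^ n \<Longrightarrow> word (Suc n) (x * 4 ^ n + j) = x # word n j"
  by simp

lemma bij_betw_word: "bij_betw (word n) {0..<4 ^ n} (Wn n)"
proof (induction n)
  case 0
  then show ?case by (auto simp: bij_betw_def Wn_def)
next
  case (Suc n)
  have "bij_betw (\<lambda>k. (k div 4 ^ n, k mod 4 ^ n)) {0..<4 ^ Suc n} ({0..<4} \<times> {0..<4 ^ n :: nat})"
  proof (rule bij_betwI[where g = "\<lambda>(x, j). x * 4 ^ n + j"])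
    show "(\<lambda>k. (k div 4 ^ n, k mod 4 ^ n)) \<in> {0..<4 ^ Suc n} \<rightarrow> {0..<4} \<times> {0..<4 ^ n :: nat}"
      by (auto simp: less_mult_imp_div_less mult.commute)
    have "x * 4 ^ n + j < 4 * 4 ^ n" if "x < 4" "j < 4 ^ n" for x j :: nat
    proof -
      have "x * 4 ^ n + j < Suc x * 4 ^ n" using that by simp
      also have "\<dots> \<le> 4 * 4 ^ n" using that by (intro mult_right_mono) auto
      finally show ?thesis .
    qed
    then show "(\<lambda>(x, j). x * 4 ^ n + j) \<in> {0..<4} \<times> {0..<4 ^ n :: nat} \<rightarrow> {0..<4 ^ Suc n}"
      by auto
  qed (auto simp: div_mult_mod_eq)
  moreover have "bij_betw (map_prod id (word n)) ({0..<4} \<times> {0..<4 ^ n}) ({0..<4::nat} \<times> Wn n)"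
    using Suc by (intro bij_betw_map_prod) auto
  moreover have "bij_betw (\<lambda>(x, w). x # w) ({0..<4} \<times> Wn n) (Wn (Suc n))"
    unfolding Wn_Suc by (auto simp: bij_betw_def inj_on_def)
  ultimately have "bij_betw ((\<lambda>(x, w). x # w) \<circ> (map_prod id (word n) \<circ> (\<lambda>k. (k div 4 ^ n, k mod 4 ^ n))))
      {0..<4 ^ Suc n} (Wn (Suc n))"
    by (intro bij_betw_trans)
  also have "((\<lambda>(x, w). x # w) \<circ> (map_prod id (word n) \<circ> (\<lambda>k. (k div 4 ^ n, k mod 4 ^ n)))) = word (Suc n)"
    by (auto simp: fun_eq_iff)
  finally show ?case .
qed

lemma word_eq_iff: "i < 4 ^ n \<Longrightarrow> j < 4 ^ n \<Longrightarrow> word n i = word n j \<longleftrightarrow> i = j"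
  using inj_on_eq_iff[OF bij_betw_imp_inj_on[OF bij_betw_word[of n]], of i j] by simp

lemma finite_Wn: "finite (Wn n)"
  using bij_betw_finite[OF bij_betw_word] by simp

text \<open>Transport of permutations along b preserves signs, so a Leibniz sum over any finite
  index set becomes a matrix determinant.\<close>

lemma leibniz_eq_det:
  fixes M :: "'a \<Rightarrow> 'a \<Rightarrow> 'b :: comm_ring_1"
  assumes b: "bij_betw b {0..<N} W"
  shows "(\<Sum>p\<in>{p. p permutes W}. of_int (sign p) * (\<Prod>u\<in>W. M u (p u)))
    = Determinant.det (Matrix.mat N N (\<lambda>(i, j). M (b i) (b j)))"
proof -
  have inj: "inj_on b {0..<N}" and im: "b ` {0..<N} = W" using b by (auto simp: bij_betw_def)
  let ?h = "map_permutation {0..<N} b"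
  have bij: "bij_betw ?h {p. p permutes {0..<N}} {p. p permutes W}"
  proof (rule bij_betwI[where g = "map_permutation W (inv_into {0..<N} b)"])
    show "?h \<in> {p. p permutes {0..<N}} \<rightarrow> {p. p permutes W}"
      using map_permutation_permutes[OF b] by auto
    show "map_permutation W (inv_into {0..<N} b) \<in> {p. p permutes W} \<rightarrow> {p. p permutes {0..<N}}"
      using map_permutation_permutes[OF bij_betw_inv_into[OF b]] by auto
    show "map_permutation W (inv_into {0..<N} b) (?h p) = p" if "p \<in> {p. p permutes {0..<N}}" for p
      using that b inv_into_f_f[OF inj] by (intro map_permutation_compose_inv) auto
    show "?h (map_permutation W (inv_into {0..<N} b) p) = p" if "p \<in> {p. p permutes W}" for p
      using that bij_betw_inv_into[OF b] im f_inv_into_f[of _ b "{0..<N}"]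
      by (intro map_permutation_compose_inv) auto
  qed
  have "(\<Sum>p\<in>{p. p permutes W}. of_int (sign p) * (\<Prod>u\<in>W. M u (p u)))
      = (\<Sum>p\<in>{p. p permutes {0..<N}}. of_int (sign (?h p)) * (\<Prod>u\<in>W. M u (?h p u)))"
    by (rule sum.reindex_bij_betw[OF bij, symmetric])
  also have "\<dots> = (\<Sum>p\<in>{p. p permutes {0..<N}}. of_int (sign p) *
      (\<Prod>i = 0..<N. Matrix.mat N N (\<lambda>(i, j). M (b i) (b j)) $$ (i, p i)))"
  proof (intro sum.cong refl arg_cong2[where f = times])
    fix p assume "p \<in> {p. p permutes {0..<N}}"
    then have p: "p permutes {0..<N}" by simp
    show "of_int (sign (?h p)) = (of_int (sign p) :: 'b)"
      using p inj by (subst sign_map_permutation) auto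
    have "(\<Prod>u\<in>W. M u (?h p u)) = (\<Prod>i = 0..<N. M (b i) (?h p (b i)))"
      by (rule prod.reindex_bij_betw[OF b, symmetric])
    also have "\<dots> = (\<Prod>i = 0..<N. Matrix.mat N N (\<lambda>(i, j). M (b i) (b j)) $$ (i, p i))"
      using permutes_in_image[OF p] by (intro prod.cong refl) (auto simp: map_permutation_apply[OF inj])
    finally show "(\<Prod>u\<in>W. M u (?h p u)) = (\<Prod>i = 0..<N. Matrix.mat N N (\<lambda>(i, j). M (b i) (b j)) $$ (i, p i))" .
  qed
  also have "\<dots> = Determinant.det (Matrix.mat N N (\<lambda>(i, j). M (b i) (b j)))"
    by (subst det_def'[of _ N]) auto
  finally show ?thesis .
qed

text \<open>Evaluated at a number t instead of having polynomial entries, because the elimination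
  divides by t - 4.\<close>

definition char_mat :: "nat \<Rightarrow> real \<Rightarrow> real mat" where
  "char_mat n t = Matrix.mat (4 ^ n) (4 ^ n)
     (\<lambda>(i, j). (if i = j then t else 0) - An (word n i) (word n j))"

lemma poly_charpoly: "poly (charpoly n) t = Determinant.det (char_mat n t)"
proof -
  have "poly (charpoly n) t = (\<Sum>p\<in>{p. p permutes Wn n}. of_int (sign p) *
      (\<Prod>u\<in>Wn n. (if u = p u then t else 0) - An u (p u)))"
    unfolding charpoly_def poly_sum poly_mult poly_prod
  proof (intro sum.cong refl arg_cong2[where f = times] prod.cong)
    fix p :: "nat list \<Rightarrow> nat list" and u
    show "poly (of_int (sign p)) t = of_int (sign p)" by (simp add: sign_def)
    show "poly [:- An u (p u), if p u = u then 1 else 0:] t = (if u = p u then t else 0) - An u (p u)"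
      by auto
  qed
  also have "\<dots> = Determinant.det (Matrix.mat (4 ^ n) (4 ^ n)
      (\<lambda>(i, j). (if word n i = word n j then t else 0) - An (word n i) (word n j)))"
    by (rule leibniz_eq_det[OF bij_betw_word])
  also have "Matrix.mat (4 ^ n) (4 ^ n)
      (\<lambda>(i, j). (if word n i = word n j then t else 0) - An (word n i) (word n j)) = char_mat n t"
    unfolding char_mat_def
    by (rule eq_matI) (simp_all add: word_eq_iff)
  finally show ?thesis .
qed

section \<open>Blocks of the finite adjacency matrix and their elimination\<close>

lemma inj_ei_fin: "i \<noteq> 0 \<Longrightarrow> ei_fin i u = ei_fin i v \<Longrightarrow> u = v"
proof (induction u arbitrary: v)
  case Nil
  then show ?case by (cases v) (auto split: if_splits)
next
  case (Cons x u)
  then show ?case by (cases v) (auto split: if_splits)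
qed

lemma ei_fin_mem_Wn: "i < 4 \<Longrightarrow> u \<in> Wn n \<Longrightarrow> ei_fin i u \<in> Wn n"
proof (induction u arbitrary: n)
  case (Cons x u)
  then show ?case by (cases n) (auto simp: Wn_def)
qed (auto simp: Wn_def)

lemma An_commute: "An u v = An v u"
  by (simp add: An_def add.commute)

lemma An_Cons_00: "An (0 # u) (0 # v) = 0"
  by (simp add: An_def)

lemma An_Cons_0: "i \<in> {1,2,3} \<Longrightarrow>
    An (0 # u) (i # v) = (if ei_fin i u = v then 1 else 0) + (if u = v then 1 else 0)"
  by (auto simp: An_def)

lemma An_Cons_pos: "i \<in> {1,2,3} \<Longrightarrow> j \<in> {1,2,3} \<Longrightarrow>
    An (i # u) (j # v) = (if i # u = j # v then 4 else 0)"
  by (auto simp: An_def)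

lemma sum_nonzero_block:
  fixes h :: "nat list \<Rightarrow> real"
  shows "(\<Sum>k<3 * 4 ^ n. h (word (Suc n) (4 ^ n + k))) = (\<Sum>i\<in>{1,2,3}. \<Sum>w\<in>Wn n. h (i # w))"
proof -
  have "(\<Sum>k<3 * 4 ^ n. h (word (Suc n) (4 ^ n + k)))
      = (\<Sum>m<3. \<Sum>k\<in>{m * 4 ^ n..<m * 4 ^ n + 4 ^ n}. h (word (Suc n) (4 ^ n + k)))"
    by (rule sum.nat_group[symmetric])
  also have "\<dots> = (\<Sum>m<3. \<Sum>j\<in>{0..<4 ^ n}. h (word (Suc n) (Suc m * 4 ^ n + j)))"
  proof (rule sum.cong[OF refl])
    fix m
    show "(\<Sum>k\<in>{m * 4 ^ n..<m * 4 ^ n + 4 ^ n}. h (word (Suc n) (4 ^ n + k)))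
        = (\<Sum>j\<in>{0..<4 ^ n}. h (word (Suc n) (Suc m * 4 ^ n + j)))"
      by (rule sum.reindex_bij_witness[of _ "\<lambda>j. m * 4 ^ n + j" "\<lambda>k. k - m * 4 ^ n"])
         (auto simp: algebra_simps simp del: word.simps)
  qed
  also have "\<dots> = (\<Sum>m<3. \<Sum>j\<in>{0..<4 ^ n}. h (Suc m # word n j))"
    by (intro sum.cong refl arg_cong[of _ _ h] word_block) simp
  also have "\<dots> = (\<Sum>m<3. \<Sum>w\<in>Wn n. h (Suc m # w))"
    by (intro sum.cong refl sum.reindex_bij_betw[OF bij_betw_word, of "\<lambda>w. h (_ # w)"])
  also have "\<dots> = (\<Sum>i\<in>{1,2,3}. \<Sum>w\<in>Wn n. h (i # w))"
    by (simp add: numeral_3_eq_3 lessThan_Suc numeral_2_eq_2 add.commute add.left_commute)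
  finally show ?thesis .
qed

text \<open>The block from letter 0 to letter i is I + M_i, and (I + M_i)(I + M_i^T) = 2 I + M_i +
  M_i^T; the three letters together give 6 I + A_n.\<close>

lemma sum_An_product:
  assumes "u \<in> Wn n" "v \<in> Wn n"
  shows "(\<Sum>i\<in>{1,2,3}. \<Sum>w\<in>Wn n. An (0 # u) (i # w) * An (i # w) (0 # v))
    = (if u = v then 6 else 0) + An u v"
proof -
  have "(\<Sum>w\<in>Wn n. An (0 # u) (i # w) * An (i # w) (0 # v)) =
      (if u = v then 2 else 0) + ((if ei_fin i u = v then 1 else 0) + (if ei_fin i v = u then 1 else 0))"
    if i: "i \<in> {1,2,3}" for i
  proof -
    have e: "ei_fin i u = ei_fin i v \<longleftrightarrow> u = v" using inj_ei_fin[of i u v] i by auto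
    have m: "ei_fin i u \<in> Wn n" "ei_fin i v \<in> Wn n" using ei_fin_mem_Wn assms i by auto
    have "(\<Sum>w\<in>Wn n. An (0 # u) (i # w) * An (i # w) (0 # v)) =
      (\<Sum>w\<in>Wn n. (if ei_fin i u = w then (if ei_fin i v = w then 1 else 0) + (if v = w then 1 else 0) else 0)
        + (if u = w then (if ei_fin i v = w then 1 else 0) + (if v = w then 1 else 0) else 0))"
      by (intro sum.cong refl) (auto simp: An_commute[of "i # _"] An_Cons_0[OF i])
    also have "\<dots> = ((if ei_fin i v = ei_fin i u then 1 else 0) + (if v = ei_fin i u then 1 else 0))
        + ((if ei_fin i v = u then 1 else 0) + (if v = u then 1 else 0))"
      unfolding sum.distrib using m assms by (simp add: finite_Wn)
    also have "\<dots> = (if u = v then 2 else 0) + ((if ei_fin i u = v then 1 else 0) + (if ei_fin i v = u then 1 else 0))"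
      using e by auto
    finally show ?thesis .
  qed
  then have "(\<Sum>i\<in>{1,2,3}. \<Sum>w\<in>Wn n. An (0 # u) (i # w) * An (i # w) (0 # v)) =
    (\<Sum>i\<in>{1,2,3}. (if u = v then 2 else 0) + ((if ei_fin i u = v then 1 else 0) + (if ei_fin i v = u then 1 else 0)))"
    by (intro sum.cong refl)
  also have "\<dots> = (if u = v then 6 else 0) + An u v"
    unfolding sum.distrib[of "\<lambda>_. if u = v then 2 else 0"] An_def[symmetric] by simp
  finally show ?thesis .
qed

lemma det_char_mat_Suc:
  assumes t: "t \<noteq> 4"
  shows "Determinant.det (char_mat (Suc n) t) = (t - 4) ^ (2 * 4 ^ n) * Determinant.det (char_mat n (quad t))"
proof -
  define N where "N = (4::nat) ^ n"
  define c where "c = 1 / (t - 4)"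
  define A where "A = t \<cdot>\<^sub>m (1\<^sub>m N :: real mat)"
  define B where "B = Matrix.mat N (3 * N) (\<lambda>(j, k). - An (0 # word n j) (word (Suc n) (N + k)))"
  define C where "C = Matrix.mat (3 * N) N (\<lambda>(k, j). - An (word (Suc n) (N + k)) (0 # word n j))"
  define D where "D = (t - 4) \<cdot>\<^sub>m (1\<^sub>m (3 * N) :: real mat)"
  \<comment> \<open>A column operation of determinant 1 that clears the lower left block: C - (t -
    4) c C = 0.\<close>
  define L where "L = four_block_mat (1\<^sub>m N) (0\<^sub>m N (3 * N)) ((- c) \<cdot>\<^sub>m C) (1\<^sub>m (3 * N) :: real mat)"
  have car [simp]: "A \<in> carrier_mat N N" "B \<in> carrier_mat N (3 * N)" "C \<in> carrier_mat (3 * N) N"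
      "D \<in> carrier_mat (3 * N) (3 * N)"
    by (auto simp: A_def B_def C_def D_def)
  have low: "word (Suc n) i = 0 # word n i" if "i < N" for i
    using that by (simp add: N_def)
  have high: "\<exists>x\<in>{1,2,3}. \<exists>w. word (Suc n) i = x # w" if "N \<le> i" "i < 4 * N" for i
  proof -
    have "i div N < 4" using that by (simp add: less_mult_imp_div_less)
    moreover have "i div N \<noteq> 0" using that by (auto simp: N_def div_eq_0_iff)
    ultimately have "i div N \<in> {1,2,3}" by auto
    then show ?thesis by (auto simp: N_def)
  qed
  have injw: "word (Suc n) i = word (Suc n) j \<longleftrightarrow> i = j" if "i < 4 * N" "j < 4 * N" for i j
    using word_eq_iff[of i "Suc n" j] that by (simp add: N_def)
  have block: "char_mat (Suc n) t = four_block_mat A B C D"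
  proof (rule eq_matI)
    fix i j assume "i < dim_row (four_block_mat A B C D)" "j < dim_col (four_block_mat A B C D)"
    then have ij: "i < 4 * N" "j < 4 * N" by (auto simp: A_def D_def)
    have l: "char_mat (Suc n) t $$ (i, j) = (if i = j then t else 0) - An (word (Suc n) i) (word (Suc n) j)"
      using ij by (simp add: char_mat_def N_def del: word.simps)
    have r: "four_block_mat A B C D $$ (i, j) = (if i < N then if j < N then A $$ (i, j) else B $$ (i, j - N)
        else if j < N then C $$ (i - N, j) else D $$ (i - N, j - N))"
      using ij by (subst index_mat_four_block) (auto simp: A_def B_def C_def D_def)
    consider "i < N" "j < N" | "i < N" "N \<le> j" | "N \<le> i" "j < N" | "N \<le> i" "N \<le> j" by linarith
    then show "char_mat (Suc n) t $$ (i, j) = four_block_mat A B C D $$ (i, j)"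
    proof cases
      case 1
      then show ?thesis unfolding l r low[OF 1(1)] low[OF 1(2)] An_Cons_00 by (auto simp: A_def)
    next
      case 2
      then show ?thesis unfolding l r low[OF 2(1)] using ij by (auto simp: B_def simp del: word.simps)
    next
      case 3
      then show ?thesis unfolding l r low[OF 3(2)] using ij by (auto simp: C_def simp del: word.simps)
    next
      case 4
      obtain x w y w' where xw: "x \<in> {1,2,3}" "word (Suc n) i = x # w" "y \<in> {1,2,3}" "word (Suc n) j = y # w'"
        using high[OF 4(1) ij(1)] high[OF 4(2) ij(2)] by blast
      have "An (word (Suc n) i) (word (Suc n) j) = (if i = j then 4 else 0)"
        unfolding injw[OF ij, symmetric] unfolding xw(2,4) by (rule An_Cons_pos[OF xw(1,3)])
      then show ?thesis unfolding l r using 4 ij by (auto simp: D_def)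
    qed
  qed (auto simp: char_mat_def A_def D_def N_def)
  have cC [simp]: "(- c) \<cdot>\<^sub>m C \<in> carrier_mat (3 * N) N" by simp
  have "char_mat (Suc n) t * L = four_block_mat (A * 1\<^sub>m N + B * ((- c) \<cdot>\<^sub>m C))
      (A * 0\<^sub>m N (3 * N) + B * 1\<^sub>m (3 * N)) (C * 1\<^sub>m N + D * ((- c) \<cdot>\<^sub>m C))
      (C * 0\<^sub>m N (3 * N) + D * 1\<^sub>m (3 * N))"
    unfolding block L_def by (rule mult_four_block_mat[OF car]) auto
  \<comment> \<open>t - c (6 + A_n) = c (\<open>quad t\<close> - A_n), because t (t - 4) - 6 =
    \<open>quad t\<close>.\<close>
  also have "A * 1\<^sub>m N + B * ((- c) \<cdot>\<^sub>m C) = c \<cdot>\<^sub>m char_mat n (quad t)"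
  proof (rule eq_matI)
    fix i j assume "i < dim_row (c \<cdot>\<^sub>m char_mat n (quad t))" "j < dim_col (c \<cdot>\<^sub>m char_mat n (quad t))"
    then have ij: "i < N" "j < N" by (auto simp: char_mat_def N_def)
    have Wij: "word n i \<in> Wn n" "word n j \<in> Wn n"
      using bij_betwE[OF bij_betw_word[of n]] ij by (auto simp: N_def)
    have eqij: "word n i = word n j \<longleftrightarrow> i = j"
      using word_eq_iff ij by (simp add: N_def)
    have "(B * C) $$ (i, j) = (\<Sum>k<3 * N. An (0 # word n i) (word (Suc n) (N + k)) * An (word (Suc n) (N + k)) (0 # word n j))"
      using ij by (simp add: B_def C_def scalar_prod_def lessThan_atLeast0 del: word.simps)
    also have "\<dots> = (if i = j then 6 else 0) + An (word n i) (word n j)"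
      unfolding N_def
      by (subst sum_nonzero_block[where h = "\<lambda>w. An (0 # word n i) w * An w (0 # word n j)"])
         (simp only: sum_An_product[OF Wij] eqij)
    finally have BC: "(B * C) $$ (i, j) = (if i = j then 6 else 0) + An (word n i) (word n j)" .
    have "(A * 1\<^sub>m N + B * ((- c) \<cdot>\<^sub>m C)) $$ (i, j) = A $$ (i, j) - c * (B * C) $$ (i, j)"
      using ij by (subst mult_smult_distrib[of B N "3 * N" C N]) (auto simp: A_def B_def C_def)
    also have "\<dots> = c * ((if i = j then quad t else 0) - An (word n i) (word n j))"
    proof -
      have "c * (t * (t - 4)) = t" using t by (simp add: c_def)
      then have "c * (quad t + 6) = t" by (simp add: quad_def power2_eq_square algebra_simps)
      then show ?thesis unfolding BC using ij by (auto simp: A_def algebra_simps)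
    qed
    also have "\<dots> = (c \<cdot>\<^sub>m char_mat n (quad t)) $$ (i, j)"
      using ij by (simp add: char_mat_def N_def)
    finally show "(A * 1\<^sub>m N + B * ((- c) \<cdot>\<^sub>m C)) $$ (i, j) = (c \<cdot>\<^sub>m char_mat n (quad t)) $$ (i, j)" .
  qed (auto simp: char_mat_def A_def B_def C_def N_def)
  also have "C * 1\<^sub>m N + D * ((- c) \<cdot>\<^sub>m C) = 0\<^sub>m (3 * N) N"
  proof -
    have "D * ((- c) \<cdot>\<^sub>m C) = (t - 4) \<cdot>\<^sub>m ((- c) \<cdot>\<^sub>m C)"
      unfolding D_def using car(3) by (subst mult_smult_assoc_mat[of _ "3 * N" "3 * N" _ N])
        (auto simp: left_mult_one_mat[OF cC])
    moreover have "(t - 4) * c = 1" using t by (simp add: c_def)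
    ultimately show ?thesis by (intro eq_matI) (auto simp: C_def simp flip: mult.assoc)
  qed
  finally have prod: "char_mat (Suc n) t * L = four_block_mat (c \<cdot>\<^sub>m char_mat n (quad t))
      (A * 0\<^sub>m N (3 * N) + B * 1\<^sub>m (3 * N)) (0\<^sub>m (3 * N) N) (C * 0\<^sub>m N (3 * N) + D * 1\<^sub>m (3 * N))" .
  have "C * 0\<^sub>m N (3 * N) + D * 1\<^sub>m (3 * N) = D"
    by (simp add: right_mult_zero_mat[OF car(3)] right_mult_one_mat[OF car(4)] left_add_zero_mat[OF car(4)])
  note prod = prod[unfolded this]
  have "Determinant.det L = 1"
    unfolding L_def by (subst det_four_block_mat_upper_right_zero[of _ N _ "3 * N"]) auto
  moreover have "L \<in> carrier_mat (4 * N) (4 * N)" "char_mat (Suc n) t \<in> carrier_mat (4 * N) (4 * N)"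
    by (auto simp: L_def C_def char_mat_def N_def)
  ultimately have "Determinant.det (char_mat (Suc n) t) = Determinant.det (char_mat (Suc n) t * L)"
    by (simp add: det_mult[of _ "4 * N"])
  also have "\<dots> = Determinant.det (c \<cdot>\<^sub>m char_mat n (quad t)) * Determinant.det D"
    unfolding prod by (rule det_four_block_mat_lower_left_zero[of _ N _ "3 * N"])
      (auto simp: char_mat_def N_def A_def B_def D_def)
  also have "\<dots> = c ^ N * Determinant.det (char_mat n (quad t)) * (t - 4) ^ (3 * N)"
    by (simp add: D_def char_mat_def N_def)
  \<comment> \<open>N of the factors t - 4 cancel against c^N.\<close>
  also have "(t - 4) ^ (3 * N) = (t - 4) ^ N * (t - 4) ^ (2 * N)"
    by (simp flip: power_add)
  also have "c ^ N * Determinant.det (char_mat n (quad t)) * ((t - 4) ^ N * (t - 4) ^ (2 * N))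
      = (c * (t - 4)) ^ N * ((t - 4) ^ (2 * N) * Determinant.det (char_mat n (quad t)))"
    by (simp add: power_mult_distrib)
  also have "c * (t - 4) = 1" using t by (simp add: c_def)
  finally show ?thesis by (simp add: N_def)
qed

section \<open>Factorization of the characteristic polynomials\<close>

lemma charpoly_0: "charpoly 0 = [:-6, 1:]"
proof -
  have "Wn 0 = {[]}" by (auto simp: Wn_def)
  then show ?thesis by (simp add: charpoly_def An_def)
qed

text \<open>The determinant identity is known for t other than 4; a nonzero difference would have
  only finitely many roots.\<close>

lemma charpoly_Suc: "charpoly (Suc n) = [:-4, 1:] ^ (2 * 4 ^ n) * (charpoly n \<circ>\<^sub>p [:-6, -4, 1:])"
proof (rule ccontr)
  assume neq: "charpoly (Suc n) \<noteq> [:-4, 1:] ^ (2 * 4 ^ n) * (charpoly n \<circ>\<^sub>p [:-6, -4, 1:])"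
  define d where "d = charpoly (Suc n) - [:-4, 1:] ^ (2 * 4 ^ n) * (charpoly n \<circ>\<^sub>p [:-6, -4, 1:])"
  have "poly d t = 0" if "t \<noteq> 4" for t
  proof -
    have "poly [:-6, -4, 1:] t = quad t" by (simp add: quad_def power2_eq_square algebra_simps)
    then show ?thesis
      using det_char_mat_Suc[OF that, of n] by (simp add: d_def poly_charpoly poly_pcompose poly_power)
  qed
  then have "UNIV - {4} \<subseteq> {t. poly d t = 0}" by auto
  moreover have "finite {t. poly d t = 0}" using neq by (intro poly_roots_finite) (simp add: d_def)
  ultimately have "finite (UNIV - {4 :: real})" by (rule finite_subset)
  then show False by (simp add: infinite_UNIV_char_0)
qed

text \<open>Preimages of the single eigenvalue 6 at n = 0.\<close>

definition top_level :: "nat \<Rightarrow> real set" where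
  "top_level n = {x. (quad ^^ n) x = 6}"

lemma top_level_0: "top_level 0 = {6}"
  by (simp add: top_level_def)

lemma top_level_Suc: "top_level (Suc n) = quad -` top_level n"
  by (auto simp: top_level_def funpow_swap1)

lemma top_level_inside: "top_level n \<subseteq> {-2..6}"
  using funpow_quad_inside[of n _ 0] by (auto simp: top_level_def)

lemma finite_top_level: "finite (top_level n)"
  by (induction n) (simp_all add: top_level_0 top_level_Suc finite_vimage_quad top_level_inside)

lemma card_top_level: "card (top_level n) = 2 ^ n"
  by (induction n) (simp_all add: top_level_0 top_level_Suc card_vimage_quad top_level_inside finite_top_level)

lemma pcompose_power: "(p ^ n) \<circ>\<^sub>p q = (p \<circ>\<^sub>p q) ^ n"
  by (induction n) (simp_all add: pcompose_1 pcompose_mult)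

definition root_poly :: "real set \<Rightarrow> real poly" where
  "root_poly B = (\<Prod>a\<in>B. [:-a, 1:])"

lemma pcompose_root_poly:
  assumes "finite B" "B \<subseteq> {-2..6}"
  shows "root_poly B \<circ>\<^sub>p [:-6, -4, 1:] = root_poly (quad -` B)"
proof -
  have "root_poly B \<circ>\<^sub>p [:-6, -4, 1:] = (\<Prod>a\<in>B. [:-a, 1:] \<circ>\<^sub>p [:-6, -4, 1:])"
    unfolding root_poly_def by (rule pcompose_prod)
  also have "\<dots> = (\<Prod>a\<in>B. [:- (2 + sqrt (10 + a)), 1:] * [:- (2 - sqrt (10 + a)), 1:])"
  proof (rule prod.cong)
    fix a assume "a \<in> B"
    then have "sqrt (10 + a) * sqrt (10 + a) = 10 + a" using assms by auto
    then show "[:-a, 1:] \<circ>\<^sub>p [:-6, -4, 1:] = [:- (2 + sqrt (10 + a)), 1:] * [:- (2 - sqrt (10 + a)), 1:]"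
      by (simp add: pcompose_pCons algebra_simps)
  qed simp
  also have "\<dots> = root_poly (quad -` B)"
    unfolding root_poly_def by (rule prod_vimage_quad[OF assms, symmetric])
  finally show ?thesis .
qed

text \<open>Passing from length m to m + 1 creates the root 4 with multiplicity 2 * 4^m, and k
  further compositions move it to level k of length n = m + 1 + k, so m = n - 1 - k.\<close>

lemma charpoly_factorization:
  "charpoly n = (\<Prod>k<n. root_poly (level k) ^ (2 * 4 ^ (n - 1 - k))) * root_poly (top_level n)"
proof (induction n)
  case 0
  then show ?case by (simp add: charpoly_0 root_poly_def top_level_0)
next
  case (Suc n)
  have "charpoly n \<circ>\<^sub>p [:-6, -4, 1:] =
      (\<Prod>k<n. root_poly (level (Suc k)) ^ (2 * 4 ^ (n - 1 - k))) * root_poly (top_level (Suc n))"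
    unfolding Suc pcompose_mult pcompose_prod
    by (simp add: pcompose_power pcompose_root_poly finite_level level_inside finite_top_level
        top_level_inside level_Suc top_level_Suc)
  moreover have "[:-4, 1:] = root_poly (level 0)" by (simp add: level_0 root_poly_def)
  ultimately show ?case
    unfolding charpoly_Suc prod.lessThan_Suc_shift by (simp add: mult.assoc)
qed

lemma proots_root_poly: "finite B \<Longrightarrow> proots (root_poly B) = mset_set B"
  unfolding root_poly_def by (subst proots_prod) (auto simp: sum_unfold_sum_mset)

lemma root_poly_nonzero: "finite B \<Longrightarrow> root_poly B \<noteq> 0"
  unfolding root_poly_def by (simp add: prod_zero_iff)

lemma proots_charpoly: "proots (charpoly n) =
    (\<Sum>k<n. repeat_mset (2 * 4 ^ (n - 1 - k)) (mset_set (level k))) + mset_set (top_level n)"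
proof -
  have "proots (charpoly n) = proots (\<Prod>k<n. root_poly (level k) ^ (2 * 4 ^ (n - 1 - k))) + proots (root_poly (top_level n))"
    unfolding charpoly_factorization
    by (rule proots_mult) (simp_all add: root_poly_nonzero finite_level finite_top_level prod_zero_iff)
  also have "proots (\<Prod>k<n. root_poly (level k) ^ (2 * 4 ^ (n - 1 - k)))
      = (\<Sum>k<n. proots (root_poly (level k) ^ (2 * 4 ^ (n - 1 - k))))"
    by (rule proots_prod) (simp add: root_poly_nonzero finite_level)
  finally show ?thesis by (simp add: proots_power proots_root_poly finite_level finite_top_level)
qed

text \<open>2 * 4^(n-1-k) / 4^n = 1/(2 * 4^k): the share of a point of level k is the same for all n
  > k.\<close>

definition root_fraction :: "nat \<Rightarrow> real set \<Rightarrow> real" where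
  "root_fraction n A = (\<Sum>k<n. real (card (level k \<inter> A)) / (2 * 4 ^ k)) + real (card (top_level n \<inter> A)) / 4 ^ n"

lemma size_filter_proots_charpoly:
  "real (size (filter_mset (\<lambda>x. x \<in> A) (proots (charpoly n)))) / 4 ^ n = root_fraction n A"
proof -
  have size1: "size (filter_mset (\<lambda>x. x \<in> A) (mset_set B)) = card (B \<inter> A)" if "finite B" for B :: "real set"
    using that by (simp add: filter_mset_mset_set Int_def)
  have rep: "size (filter_mset (\<lambda>x. x \<in> A) (repeat_mset m M)) = m * size (filter_mset (\<lambda>x. x \<in> A) M)"
    for m and M :: "real multiset"
    by (induction m) (simp_all add: repeat_mset_Suc)
  have sum: "size (filter_mset (\<lambda>x. x \<in> A) (\<Sum>k\<in>K. f k)) = (\<Sum>k\<in>K. size (filter_mset (\<lambda>x. x \<in> A) (f k)))"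
    if "finite K" for K :: "nat set" and f :: "nat \<Rightarrow> real multiset"
    using that by (induction K rule: finite_induct) auto
  have "real (size (filter_mset (\<lambda>x. x \<in> A) (proots (charpoly n)))) / 4 ^ n =
     (\<Sum>k<n. real (2 * 4 ^ (n - 1 - k) * card (level k \<inter> A)) / 4 ^ n) + real (card (top_level n \<inter> A)) / 4 ^ n"
    unfolding proots_charpoly
    by (simp add: sum rep size1 finite_level finite_top_level add_divide_distrib sum_divide_distrib Int_def)
  also have "(\<Sum>k<n. real (2 * 4 ^ (n - 1 - k) * card (level k \<inter> A)) / 4 ^ n)
      = (\<Sum>k<n. real (card (level k \<inter> A)) / (2 * 4 ^ k))"
  proof (intro sum.cong refl)
    fix k assume "k \<in> {..<n}"
    then obtain m where n: "n = Suc (k + m)" using less_imp_Suc_add by auto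
    show "real (2 * 4 ^ (n - 1 - k) * card (level k \<inter> A)) / 4 ^ n = real (card (level k \<inter> A)) / (2 * 4 ^ k)"
      unfolding n by (simp add: power_add field_simps)
  qed
  finally show ?thesis by (simp add: root_fraction_def)
qed

section \<open>The spectral measure\<close>

lemma root_fraction_UNIV: "root_fraction n UNIV = 1"
proof -
  have "root_fraction n UNIV = (\<Sum>k<n. (1/2) ^ Suc k) + (1/2) ^ n"
  proof -
    have "real (2 ^ k) / (2 * 4 ^ k) = (1/2) ^ Suc k" "real (2 ^ k) / 4 ^ k = (1/2) ^ k" for k
      by (simp_all add: power_divide field_simps flip: power_mult_distrib)
    then show ?thesis by (simp only: root_fraction_def Int_UNIV_right card_level card_top_level)
  qed
  also have "\<dots> = 1" by (induction n) auto
  finally show ?thesis .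
qed

lemma size_proots_charpoly: "size (proots (charpoly n)) = 4 ^ n"
proof -
  have "real (size (proots (charpoly n))) / 4 ^ n = 1"
    using size_filter_proots_charpoly[of UNIV n] by (simp add: root_fraction_UNIV)
  then have "real (size (proots (charpoly n))) = real (4 ^ n)" by simp
  then show ?thesis by (simp only: of_nat_eq_iff)
qed

section \<open>The finite spectral measures and their weak limit\<close>

definition pmf_n :: "nat \<Rightarrow> real pmf" where
  "pmf_n n = pmf_of_multiset (proots (charpoly n))"

lemma measure_pmf_n: "measure (measure_pmf (pmf_n n)) A = root_fraction n A"
proof -
  let ?M = "proots (charpoly n)"
  have ne: "?M \<noteq> {#}" using size_proots_charpoly[of n] by auto
  have "measure (measure_pmf (pmf_n n)) A = measure (measure_pmf (pmf_n n)) (A \<inter> set_mset ?M)"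
    using measure_Int_set_pmf[of "pmf_n n" A] by (simp add: pmf_n_def set_pmf_of_multiset[OF ne] del: set_count_proots)
  also have "\<dots> = (\<Sum>x\<in>A \<inter> set_mset ?M. real (count ?M x) / 4 ^ n)"
    by (subst measure_measure_pmf_finite)
       (simp_all add: pmf_n_def pmf_of_multiset[OF ne] size_proots_charpoly del: set_count_proots count_proots)
  also have "\<dots> = real (size (filter_mset (\<lambda>x. x \<in> A) ?M)) / 4 ^ n"
    unfolding size_multiset_overloaded_eq of_nat_sum sum_divide_distrib
    by (intro sum.cong) auto
  finally show ?thesis unfolding size_filter_proots_charpoly .
qed

text \<open>\<open>measure_of\<close> returns the given set function only if it is a measure; the
  image of a pmf supplies the countable additivity.\<close>

lemma mu_n_eq_distr: "mu_n n = distr (measure_pmf (pmf_n n)) borel (\<lambda>x. x)"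
proof -
  let ?N = "distr (measure_pmf (pmf_n n)) borel (\<lambda>x. x :: real)"
  have "mu_n n = measure_of UNIV (sets borel) (emeasure ?N)"
    unfolding mu_n_def
  proof (rule measure_of_eq)
    fix A :: "real set" assume "A \<in> sigma_sets UNIV (sets borel)"
    then have "A \<in> sets borel" using sets.sigma_sets_eq[of "borel :: real measure"] by simp
    then show "ennreal (real (size (filter_mset (\<lambda>x. x \<in> A) (proots (charpoly n)))) / 4 ^ n) = emeasure ?N A"
      unfolding size_filter_proots_charpoly
      by (simp add: emeasure_distr measure_pmf.emeasure_eq_measure measure_pmf_n)
  qed simp
  also have "\<dots> = ?N" using measure_of_of_measure[of ?N] by simp
  finally show ?thesis .
qed

lemma real_distribution_mu_n: "real_distribution (mu_n n)"
  unfolding mu_n_eq_distr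
  by (rule prob_space.real_distribution_distr[OF prob_space_measure_pmf]) simp

text \<open>The $2^k$ points at level $k$ carry total mass $2^{-k-1}$.\<close>

definition kns_measure :: "real measure" where
  "kns_measure = distr (measure_pmf (bind_pmf (geometric_pmf (1/2)) (\<lambda>k. pmf_of_set (level k)))) borel (\<lambda>x. x)"

lemma real_distribution_kns_measure: "real_distribution kns_measure"
  unfolding kns_measure_def
  by (rule prob_space.real_distribution_distr[OF prob_space_measure_pmf]) simp

lemma summable_level_masses: "summable (\<lambda>k. real (card (level k \<inter> A)) / (2 * 4 ^ k))"
proof (rule summable_comparison_test')
  show "summable (\<lambda>k. (1/2 :: real) ^ Suc k)" using power_half_series by (rule sums_summable)
  fix k
  have "card (level k \<inter> A) \<le> 2 ^ k" unfolding card_level[symmetric] by (intro card_mono finite_level) auto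
  then have "real (card (level k \<inter> A)) \<le> 2 ^ k" by (simp flip: of_nat_le_iff)
  then have "real (card (level k \<inter> A)) / (2 * 4 ^ k) \<le> 2 ^ k / (2 * 4 ^ k)" by (intro divide_right_mono) auto
  also have "\<dots> = (1/2) ^ Suc k" by (simp add: power_divide field_simps flip: power_mult_distrib)
  finally show "norm (real (card (level k \<inter> A)) / (2 * 4 ^ k)) \<le> (1/2) ^ Suc k" by simp
qed

lemma measure_kns_measure:
  assumes "A \<in> sets borel"
  shows "measure kns_measure A = (\<Sum>k. real (card (level k \<inter> A)) / (2 * 4 ^ k))"
proof -
  have ne: "level k \<noteq> {}" for k using card_level[of k] by auto
  have "emeasure kns_measure A = (\<Sum>k. ennreal (pmf (geometric_pmf (1/2)) k) * emeasure (measure_pmf (pmf_of_set (level k))) A)"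
    using assms by (simp add: kns_measure_def emeasure_distr nn_integral_measure_pmf nn_integral_count_space_nat)
  also have "\<dots> = (\<Sum>k. ennreal (real (card (level k \<inter> A)) / (2 * 4 ^ k)))"
  proof (rule suminf_cong)
    fix k
    have "(1/2) ^ k * (1/2) * (real (card (level k \<inter> A)) / 2 ^ k) = real (card (level k \<inter> A)) / (2 * 4 ^ k)"
      by (simp add: power_divide flip: power_mult_distrib)
    then show "ennreal (pmf (geometric_pmf (1/2)) k) * emeasure (measure_pmf (pmf_of_set (level k))) A
        = ennreal (real (card (level k \<inter> A)) / (2 * 4 ^ k))"
      by (simp add: emeasure_pmf_of_set[OF ne finite_level] card_level flip: ennreal_mult)
  qed
  also have "\<dots> = ennreal (\<Sum>k. real (card (level k \<inter> A)) / (2 * 4 ^ k))"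
    by (rule suminf_ennreal2) (auto intro: summable_level_masses)
  finally show ?thesis
    by (simp add: measure_def suminf_nonneg summable_level_masses)
qed

text \<open>The distribution functions of \<open>mu_n\<close> are partial sums of the series for
  \<open>kns_measure\<close>, up to the share of the preimages of 6, which is at most 2^n /
  4^n.\<close>

lemma weak_conv_mu_n: "weak_conv_m mu_n kns_measure"
  unfolding weak_conv_m_def weak_conv_def
proof (intro allI impI)
  fix x :: real
  have cdf_n: "cdf (mu_n n) x = root_fraction n {..x}" for n
    unfolding cdf_def mu_n_eq_distr by (subst measure_distr) (auto simp: measure_pmf_n)
  have "(\<lambda>n. \<Sum>k<n. real (card (level k \<inter> {..x})) / (2 * 4 ^ k)) \<longlonglongrightarrow> cdf kns_measure x"
    unfolding cdf_def by (subst measure_kns_measure) (auto intro: summable_LIMSEQ summable_level_masses)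
  moreover have "(\<lambda>n. real (card (top_level n \<inter> {..x})) / 4 ^ n) \<longlonglongrightarrow> 0"
  proof (rule tendsto_sandwich[OF _ _ tendsto_const LIMSEQ_power_zero[of "1/2 :: real"]])
    have "real (card (top_level n \<inter> {..x})) / 4 ^ n \<le> (1/2) ^ n" for n
    proof -
      have "card (top_level n \<inter> {..x}) \<le> 2 ^ n"
        unfolding card_top_level[symmetric] by (intro card_mono finite_top_level) auto
      then have "real (card (top_level n \<inter> {..x})) \<le> 2 ^ n" by (simp flip: of_nat_le_iff)
      then have "real (card (top_level n \<inter> {..x})) / 4 ^ n \<le> 2 ^ n / 4 ^ n" by (intro divide_right_mono) auto
      also have "\<dots> = (1/2) ^ n" by (simp flip: power_divide)
      finally show ?thesis .
    qed
    then show "\<forall>\<^sub>F n in sequentially. real (card (top_level n \<inter> {..x})) / 4 ^ n \<le> (1/2) ^ n" by simp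
  qed auto
  ultimately show "(\<lambda>n. cdf (mu_n n) x) \<longlonglongrightarrow> cdf kns_measure x"
    unfolding cdf_n root_fraction_def using tendsto_add by fastforce
qed

text \<open>Characteristic functions converge pointwise along a weakly convergent sequence, and they
  determine the limit distribution.\<close>

lemma weak_limit_unique:
  assumes "real_distribution \<mu>" "weak_conv_m mu_n \<mu>"
  shows "\<mu> = kns_measure"
proof (rule Levy_uniqueness[OF assms(1) real_distribution_kns_measure])
  show "char \<mu> = char kns_measure"
    using levy_continuity1[OF real_distribution_mu_n assms]
      levy_continuity1[OF real_distribution_mu_n real_distribution_kns_measure weak_conv_mu_n]
    by (intro ext LIMSEQ_unique)
qed

lemma measure_kns_point:
  assumes "x \<in> level n"
  shows "measure kns_measure {x} = 1 / (2 * 4 ^ n)"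
proof -
  have "real (card (level k \<inter> {x})) / (2 * 4 ^ k) = (if k = n then 1 / (2 * 4 ^ k) else 0)" for k
  proof (cases "k = n")
    case True
    then show ?thesis using assms by simp
  next
    case False
    then have "level k \<inter> {x} = {}" using level_disjoint[OF False] assms by auto
    then show ?thesis using False by simp
  qed
  then have "measure kns_measure {x} = (\<Sum>k. if k = n then 1 / (2 * 4 ^ k) else 0)"
    by (subst measure_kns_measure) auto
  also have "\<dots> = 1 / (2 * 4 ^ n)"
    by (rule sums_unique[symmetric]) (rule sums_single)
  finally show ?thesis .
qed

lemma countable_levels: "countable (\<Union>n. level n)"
  by (rule countable_UN[OF _ countable_finite[OF finite_level]]) simp

lemma measure_kns_levels: "measure kns_measure (\<Union>n. level n) = 1"
proof -
  have "(\<Union>n. level n) \<in> sets borel"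
    by (rule sets.countable[OF _ countable_levels]) simp
  then have "measure kns_measure (\<Union>n. level n) = (\<Sum>k. real (card (level k \<inter> (\<Union>n. level n))) / (2 * 4 ^ k))"
    by (rule measure_kns_measure)
  also have "\<dots> = (\<Sum>k. (1/2) ^ Suc k)"
  proof (rule suminf_cong)
    fix k
    have "level k \<inter> (\<Union>n. level n) = level k" by auto
    then show "real (card (level k \<inter> (\<Union>n. level n))) / (2 * 4 ^ k) = (1/2) ^ Suc k"
      by (simp add: card_level power_divide field_simps flip: power_mult_distrib)
  qed
  also have "\<dots> = 1" using power_half_series by (rule sums_unique[symmetric])
  finally show ?thesis .
qed

theorem theorem3p7:
  fixes w :: "nat \<Rightarrow> nat"
  assumes "w \<in> Xinf" and "infinite (orbit w)"
  defines "S \<equiv> closure ({4} \<union> (\<Union>n\<in>{1..}. R n))"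
  defines "I \<equiv> {4} \<union> (\<Union>n\<in>{1..}. R n)"
  shows "op_spectrum (orbit w) (adj_op (orbit w)) = complex_of_real ` S
    \<and> cantor_set (S - I) \<and> S - I \<in> null_sets lborel
    \<and> (\<forall>x. x \<in> S - I \<longrightarrow> 4 - x \<in> S - I)
    \<and> countable I \<and> (\<forall>x\<in>I. x isolated_in S)
    \<and> (\<exists>\<mu>. real_distribution \<mu> \<and> weak_conv_m mu_n \<mu>)
    \<and> (\<forall>\<mu>. real_distribution \<mu> \<and> weak_conv_m mu_n \<mu> \<longrightarrow>
          measure \<mu> I = 1
        \<and> measure \<mu> {4} = 1/2
        \<and> (\<forall>n\<ge>1. \<forall>x\<in>R n. measure \<mu> {x} = 1 / (2 * 4 ^ n)))"
proof -
  have I: "I = (\<Union>n. level n)" unfolding I_def by (rule points_eq_levels)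
  have S: "S = (\<Union>n. level n) \<union> julia"
    unfolding S_def points_eq_levels by (rule closure_levels)
  have SI: "S - I = julia" unfolding S I using level_julia_disjoint by auto
  have R: "R n = level n" if "n \<ge> 1" for n
    using R_eq_level[of "n - 1"] that by simp
  have "measure kns_measure {4} = 1/2" using measure_kns_point[of 4 0] by (simp add: level_0)
  then have mass: "measure \<mu> I = 1 \<and> measure \<mu> {4} = 1/2
      \<and> (\<forall>n\<ge>1. \<forall>x\<in>R n. measure \<mu> {x} = 1 / (2 * 4 ^ n))"
    if "real_distribution \<mu> \<and> weak_conv_m mu_n \<mu>" for \<mu>
    using weak_limit_unique[of \<mu>] that measure_kns_levels measure_kns_point R unfolding I by auto
  have "op_spectrum (orbit w) (adj_op (orbit w)) = complex_of_real ` S"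
    unfolding S by (rule spectrum_invariant[OF invariant_orbit[OF assms(1)]])
  moreover have "\<forall>x\<in>I. x isolated_in S" unfolding S I using level_isolated by blast
  moreover have "countable I" unfolding I by (rule countable_levels)
  ultimately show ?thesis
    unfolding SI
    using cantor_julia julia_null julia_symmetric mass real_distribution_kns_measure weak_conv_mu_n
    by blast
qed

end
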